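(* Let $\mathcal{A} \subset \mathbb{P}^{3}_{\mathbb{C}}$ (equivalently, a central arrangement of hyperplanes in $\mathbb{C}^4$ with coordinates $x,y,z,w$) be one of the $14$ rigid Cynk--Szemberg octic hyperplane arrangements, i.e. one of the arrangements of eight hyperplanes defined by the vanishing of one of the following polynomials: \begin{itemize} \item $Q_{1} = xyzw(x+y)(y+z)(z+w)(w+x)$; \item $Q_{3} = xyzw(x+y)(y+z)(y-w)(x-y-z+w)$; \item $Q_{19} = xyzw(x+y)(y+z)(x-z-w)(x+y+z-w)$; \item $Q_{32} = xyzw(x+y)(y+z)(x-y-z-w)(x+y-z+w)$; \item $Q_{69} = xyzw(x+y)(x-y+z)(x-y-w)(x+y-z-w)$; \item $Q_{93} = xyzw(x+y)(x-y+z)(y-z-w)(x+z-w)$; \item $Q_{238} = xyzw(x+y+z-w)(x+y-z+w)(x-y+z+w)(-x+y+z+w)$; \item $Q_{239} = xyzw(x+y+z)(x+y+w)(x+z+w)(y+z+w)$; \item $Q_{240} = xyzw(x+y+z)(x+y-z+w)(x-y+z+w)(x-y-z-w)$; \item $Q_{241} = xyzw(x+y+z+w)(x+y-z-w)(y-z+w)(x+z-w)$; \item $Q_{245} = xyzw(x+y+z)(y+z+w)(x-y-w)(x-y+z+w)$; \item $Q_{\mathfrak{A}} = xyzw(x+y)(x+y+z-w)\big((\sqrt{-3}-1)x-2y+(\sqrt{-3}-1)z\big)\big(2y+(-\sqrt{-3}+1)z-2w\big)$; \item $Q_{\mathfrak{B}} = xyzw(x+y+z)(x+z-w)\big((\sqrt{-3}-1)x+(\sqrt{-3}+1)y-2z+2w\big)\big((\sqrt{-3}-1)x+(\sqrt{-3}-1)y-2z+(\sqrt{-3}+1)w\big)$;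 \item $Q_{\mathfrak{C}} = xyzw(x+y+z)\big((\sqrt{5}-1)y-2z+2w\big)\big(2x+2y+(\sqrt{5}-1)w\big)\big((-\sqrt{5}+3)x+2y+(-\sqrt{5}+1)z+(\sqrt{5}-1)w\big)$. \end{itemize} Then the type of $\mathcal{A}$ satisfies $t(\mathcal{A}) \in \{1,2,3,4,5\}$.
   Context: Everything is over $\mathbb{C}$. A central hyperplane arrangement in $\mathbb{C}^n$ is a finite set of distinct linear hyperplanes; it is identified with an arrangement of hyperplanes in $\mathbb{P}^{n-1}$. Let $S=\mathbb{C}[x_1,\ldots,x_n]$ (for $n=4$ the variables are $x,y,z,w$), and let ${\rm Der}(S)=\bigoplus_{i=1}^n S\cdot\partial_{x_i}$, where a derivation $\sum_i a_i\partial_{x_i}$ is homogeneous of degree $d$ if all $a_i$ are homogeneous polynomials of degree $d$. For each $H\in\mathcal{A}$ fix a linear form $\alpha_H$ with $\ker(\alpha_H)=H$, and let $Q=Q(\mathcal{A})=\prod_{H\in\mathcal{A}}\alpha_H$ be the defining equation of $\mathcal{A}$. The derivation module is $$D(\mathcal{A})=\{\theta\in{\rm Der}(S): \theta(\alpha_H)\in S\cdot\alpha_H \text{ for all } H\in\mathcal{A}\},$$ and $$D_0(\mathcal{A})=\{\theta\in{\rm Der}(S): \theta(Q)=0\}.$$ One has $D(\mathcal{A})=S\cdot\theta_E\oplus D_0(\mathcal{A})$ with $\theta_E=\sum_i x_i\partial_{x_i}$ the Euler derivation. The degree sequence ${\rm exp}_0(\mathcal{A})=(d_1,\ldots,d_s)$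 of $D_0(\mathcal{A})$ is the sequence of degrees, counted with multiplicity, of a minimal homogeneous generating set of the graded $S$-module $D_0(\mathcal{A})$; equivalently, the $0$-th term of the minimal graded free resolution of $D_0(\mathcal{A})$ is $\bigoplus_{i=1}^s S[-d_i]$. It is ordered so that $d_1\le d_2\le\cdots\le d_s$. The arrangement $\mathcal{A}\subset\mathbb{C}^n$ is essential if the normals of its hyperplanes span an $n$-dimensional space. For an essential arrangement $\mathcal{A}\subset\mathbb{C}^n$ of $k$ hyperplanes with ${\rm exp}_0(\mathcal{A})=(d_1,\ldots,d_s)$, $s\ge n-1$, $1\le d_1\le\cdots\le d_s$, the type of $\mathcal{A}$ is $$t(\mathcal{A})=\sum_{i=1}^{n-1}d_i-k+1.$$ For eight hyperplanes in $\mathbb{C}^4$ this is $t(\mathcal{A})=d_1+d_2+d_3-7$. A Cynk--Szemberg octic hyperplane arrangement is an arrangement of eight hyperplanes in $\mathbb{P}^3$ having only double and triple lines (lines contained in exactly two or exactly three of the hyperplanes) and only arrangement $q$-fold points (points belonging to exactly $q$ of the hyperplanes) with $q\in\{2,3,4,5\}$. Rigid means having a $0$-dimensional moduli space. The $14$ polynomials in the claim constitute the list of rigid such arrangements considered (from the classification of Cynk and Kocel-Cynk). Here $\sqrt{-3}$ denotes a fixed square root of $-3$ in $\mathbb{C}$. *)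

theory Defs
  imports "HOL-Analysis.Analysis" "HOL-Library.Poly_Mapping"
begin

text \<open>
  The polynomial ring \<open>S\<close> in variables indexed by a finite type \<open>'n\<close>: finitely supported
  coefficient functions on monomials, a monomial being an exponent map \<open>'n \<Rightarrow>\<^sub>0 nat\<close>.
\<close>

type_synonym 'n mpoly = "('n \<Rightarrow>\<^sub>0 nat) \<Rightarrow>\<^sub>0 complex"

definition Var :: "'n \<Rightarrow> 'n mpoly" where
  "Var i = Poly_Mapping.single (Poly_Mapping.single i 1) 1"

definition Const :: "complex \<Rightarrow> 'n mpoly" where
  "Const c = Poly_Mapping.single 0 c"

definition eval_poly :: "'n::finite mpoly \<Rightarrow> complex ^ 'n \<Rightarrow> complex" where
  "eval_poly p v =
     (\<Sum>m\<in>Poly_Mapping.keys p.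
        Poly_Mapping.lookup p m * (\<Prod>i\<in>UNIV. (v $ i) ^ Poly_Mapping.lookup m i))"

definition zero_locus :: "'n::finite mpoly \<Rightarrow> (complex ^ 'n) set" where
  "zero_locus p = {v. eval_poly p v = 0}"

definition homogeneous_poly :: "nat \<Rightarrow> 'n::finite mpoly \<Rightarrow> bool" where
  "homogeneous_poly d p \<longleftrightarrow>
     (\<forall>m\<in>Poly_Mapping.keys p. (\<Sum>i\<in>UNIV. Poly_Mapping.lookup m i) = d)"

text \<open>
  Subtraction of exponents truncates, but it only does so in terms whose coefficient is \<open>0\<close>.
\<close>

definition partial_deriv :: "'n \<Rightarrow> 'n mpoly \<Rightarrow> 'n mpoly" where
  "partial_deriv i p =
     (\<Sum>m\<in>Poly_Mapping.keys p.
        Poly_Mapping.single (m - Poly_Mapping.single i 1)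
          (of_nat (Poly_Mapping.lookup m i) * Poly_Mapping.lookup p m))"

text \<open>
  The derivation \<open>\<Sum>\<^sub>i a\<^sub>i \<partial>\<^sub>i\<close> is represented by its vector of coefficients \<open>a\<close>, so that \<open>Der(S)\<close> is
  the free module \<open>S\<^sup>n\<close>.
\<close>

type_synonym 'n der = "('n mpoly) ^ 'n"

definition apply_der :: "'n::finite der \<Rightarrow> 'n mpoly \<Rightarrow> 'n mpoly" where
  "apply_der \<theta> p = (\<Sum>i\<in>UNIV. \<theta> $ i * partial_deriv i p)"

definition homogeneous_der :: "nat \<Rightarrow> 'n::finite der \<Rightarrow> bool" where
  "homogeneous_der d \<theta> \<longleftrightarrow> (\<forall>i. homogeneous_poly d (\<theta> $ i))"

global_interpretation Der: module "(*s) :: 'n::finite mpoly \<Rightarrow> 'n der \<Rightarrow> 'n der"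
  by standard (simp_all add: vec_eq_iff algebra_simps)

definition linear_form :: "complex ^ 'n::finite \<Rightarrow> 'n mpoly" where
  "linear_form a = (\<Sum>i\<in>UNIV. Const (a $ i) * Var i)"

definition kernel :: "complex ^ 'n::finite \<Rightarrow> (complex ^ 'n) set" where
  "kernel a = {v. (\<Sum>i\<in>UNIV. a $ i * v $ i) = 0}"

definition central_arrangement :: "(complex ^ 'n::finite) set set \<Rightarrow> bool" where
  "central_arrangement \<A> \<longleftrightarrow> finite \<A> \<and> (\<forall>H\<in>\<A>. \<exists>a. a \<noteq> 0 \<and> H = kernel a)"

text \<open>
  The choice of a normal vector for each hyperplane changes the defining equation only by a
  nonzero constant factor, so it does not affect \<open>D0\<close>.
\<close>

definition normal_vector :: "(complex ^ 'n::finite) set \<Rightarrow> complex ^ 'n" where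
  "normal_vector H = (SOME a. a \<noteq> 0 \<and> H = kernel a)"

definition defining_equation :: "(complex ^ 'n::finite) set set \<Rightarrow> 'n mpoly" where
  "defining_equation \<A> = (\<Prod>H\<in>\<A>. linear_form (normal_vector H))"

definition D0 :: "(complex ^ 'n::finite) set set \<Rightarrow> 'n der set" where
  "D0 \<A> = {\<theta>. apply_der \<theta> (defining_equation \<A>) = 0}"

definition minimal_generators :: "'n::finite der set \<Rightarrow> 'n der set \<Rightarrow> bool" where
  "minimal_generators M G \<longleftrightarrow> Der.span G = M \<and> (\<forall>G'. G' \<subset> G \<longrightarrow> Der.span G' \<noteq> M)"

definition degree_sequence :: "'n::finite der set \<Rightarrow> nat list \<Rightarrow> bool" where
  "degree_sequence M ds \<longleftrightarrow>
     sorted ds \<and>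
     (\<exists>\<theta>s. distinct \<theta>s \<and> minimal_generators M (set \<theta>s) \<and>
           list_all2 homogeneous_der ds \<theta>s)"

text \<open>
  By the graded Nakayama lemma a finitely generated graded module has exactly one degree sequence,
  so the choice below is immaterial.  The zero derivation, which is homogeneous of every degree,
  never occurs in a minimal generating set.
\<close>

definition exp0 :: "(complex ^ 'n::finite) set set \<Rightarrow> nat list" where
  "exp0 \<A> = (SOME ds. degree_sequence (D0 \<A>) ds)"

text \<open>
  The type is meaningful for essential arrangements; for these \<open>exp0 \<A>\<close> has at least \<open>n - 1\<close> entries.
\<close>

definition arr_type :: "(complex ^ 'n::finite) set set \<Rightarrow> int" where
  "arr_type \<A> = int (sum_list (take (CARD('n) - 1) (exp0 \<A>))) - int (card \<A>) + 1"

text \<open>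
  The polynomials are listed in the order
  \<open>Q\<^sub>1, Q\<^sub>3, Q\<^sub>1\<^sub>9, Q\<^sub>3\<^sub>2, Q\<^sub>6\<^sub>9, Q\<^sub>9\<^sub>3, Q\<^sub>2\<^sub>3\<^sub>8, Q\<^sub>2\<^sub>3\<^sub>9, Q\<^sub>2\<^sub>4\<^sub>0, Q\<^sub>2\<^sub>4\<^sub>1, Q\<^sub>2\<^sub>4\<^sub>5, Q\<^sub>A, Q\<^sub>B, Q\<^sub>C\<close>; the parameter \<open>r\<close>
  stands for a square root of \<open>-3\<close>.
\<close>

definition rigid_octic_polys :: "complex \<Rightarrow> (4 mpoly) set" where
  "rigid_octic_polys r =
    (let x = Var 1; y = Var 2; z = Var 3; w = Var 4; s = complex_of_real (sqrt 5) in
     {x*y*z*w * (x + y) * (y + z) * (z + w) * (w + x),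
      x*y*z*w * (x + y) * (y + z) * (y - w) * (x - y - z + w),
      x*y*z*w * (x + y) * (y + z) * (x - z - w) * (x + y + z - w),
      x*y*z*w * (x + y) * (y + z) * (x - y - z - w) * (x + y - z + w),
      x*y*z*w * (x + y) * (x - y + z) * (x - y - w) * (x + y - z - w),
      x*y*z*w * (x + y) * (x - y + z) * (y - z - w) * (x + z - w),
      x*y*z*w * (x + y + z - w) * (x + y - z + w) * (x - y + z + w) * (- x + y + z + w),
      x*y*z*w * (x + y + z) * (x + y + w) * (x + z + w) * (y + z + w),
      x*y*z*w * (x + y + z) * (x + y - z + w) * (x - y + z + w) * (x - y - z - w),
      x*y*z*w * (x + y + z + w) * (x + y - z - w) * (y - z + w) * (x + z - w),
      x*y*z*w * (x + y + z) * (y + z + w) * (x - y - w) * (x - y + z + w),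
      x*y*z*w * (x + y) * (x + y + z - w)
        * (Const (r - 1) * x - 2 * y + Const (r - 1) * z)
        * (2 * y + Const (- r + 1) * z - 2 * w),
      x*y*z*w * (x + y + z) * (x + z - w)
        * (Const (r - 1) * x + Const (r + 1) * y - 2 * z + 2 * w)
        * (Const (r - 1) * x + Const (r - 1) * y - 2 * z + Const (r + 1) * w),
      x*y*z*w * (x + y + z)
        * (Const (s - 1) * y - 2 * z + 2 * w)
        * (2 * x + 2 * y + Const (s - 1) * w)
        * (Const (- s + 3) * x + 2 * y + Const (- s + 1) * z + Const (s - 1) * w)})"

end

(*
  Upper bound. If v lies on at least four of the hyperplanes and P is the product of the forms not
  vanishing at v, then P d_v minus a multiple of the Euler derivation lies in D_0 and has degree at
  most 4. Each arrangement has three linearly independent points v of this kind, and evaluating the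
  derivations at a generic point shows that they are independent. So d_1, d_2, d_3 <= 4.

  Lower bound. Since x, y, z, w divide Q, a quadratic element of D_0 has the form
  theta_i = x_i * sum_j M_ij x_j. Modulo the Euler derivation it is determined by the numbers
  N_ij = M_ij - M_jj, and preserving the remaining hyperplanes is a sparse linear system in the
  N_ij, whose solution space is at most one-dimensional for each arrangement. Multiplying by
  variables, D_0 has no elements of degree 0 or 1. So d_1 >= 2 and d_2, d_3 >= 3.

  Hence 8 <= d_1 + d_2 + d_3 <= 12. That the degree sequence exists is the Hilbert basis theorem for
  graded submodules of S^n, which follows from Dickson's lemma by comparing leading terms.
*)

theory Submission
  imports Defs
begin

section \<open>Polynomials\<close>

text \<open>The work is done pointwise. Instead of the divisibility of theta(alpha) by alpha, only
  the vanishing of theta(alpha) on the hyperplane is used, and it is obtained by restriction to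
  lines. The recurring tool is that a complex vector space is not a finite union of proper
  subspaces: it provides generic points, and it recovers the arrangement from the zero locus of Q,
  the only form in which it is given. Normalising modulo the Euler derivation loses nothing: a
  linear form times that derivation multiplies Q by 8 times the form, so it annihilates Q only if it
  is 0. The step from one-dimensionality to d_2 >= 3 is minimality: two proportional quadratic
  generators would make one of them redundant. Since \<open>exp0\<close> is a choice, the bounds
  rest on \<open>degree_sequence\<close> alone, and the existence of such a sequence is what gives
  the choice its property. Each arrangement then becomes a finite check: three points and a linear
  system in twelve unknowns, with N_12 as the coordinate on its solutions.\<close>

abbreviation lookup :: "('a \<Rightarrow>\<^sub>0 'b::zero) \<Rightarrow> 'a \<Rightarrow> 'b" where
  "lookup \<equiv> Poly_Mapping.lookup"

abbreviation keys :: "('a \<Rightarrow>\<^sub>0 'b::zero) \<Rightarrow> 'a set" where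
  "keys \<equiv> Poly_Mapping.keys"

lemma mpoly_induct [case_names single add]:
  fixes p :: "'n mpoly"
  assumes "\<And>m c. P (Poly_Mapping.single m c)" and "\<And>p q. P p \<Longrightarrow> P q \<Longrightarrow> P (p + q)"
  shows "P p"
proof -
  have *: "P (\<Sum>m\<in>K. Poly_Mapping.single m (lookup p m))" if "finite K" for K
    using that
  proof induction
    case empty
    show ?case using assms(1)[of 0 0] by simp
  qed (simp add: assms)
  have "(\<Sum>m\<in>keys p. Poly_Mapping.single m (lookup p m)) = p"
    by (rule poly_mapping_eqI)
      (auto simp: lookup_sum lookup_single when_def in_keys_iff)
  then show ?thesis using *[of "keys p"] by simp
qed

text \<open>Coefficients outside the support are 0, so polynomials with different supports can be
  added over one common index set.\<close>

lemma eval_poly_superset: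
  assumes "finite K" and "keys p \<subseteq> K"
  shows "eval_poly p v = (\<Sum>m\<in>K. lookup p m * (\<Prod>i\<in>UNIV. (v $ i) ^ lookup m i))"
  unfolding eval_poly_def using assms
  by (intro sum.mono_neutral_left) (auto simp: in_keys_iff)

lemma eval_poly_single:
  "eval_poly (Poly_Mapping.single m c) v = c * (\<Prod>i\<in>UNIV. (v $ i) ^ lookup m i)"
  by (subst eval_poly_superset[of "{m}"]) auto

lemma eval_poly_0 [simp]: "eval_poly 0 v = 0"
  by (simp add: eval_poly_def)

lemma eval_poly_add [simp]: "eval_poly (p + q) v = eval_poly p v + eval_poly q v"
  using keys_add[of p q]
  by (subst (1 2 3) eval_poly_superset[of "keys p \<union> keys q"])
    (auto simp: lookup_add algebra_simps sum.distrib)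

lemma eval_poly_mult [simp]: "eval_poly (p * q) v = eval_poly p v * eval_poly q v"
proof (induction p rule: mpoly_induct)
  case (single m c)
  show ?case
    by (induction q rule: mpoly_induct)
      (simp_all add: mult_single eval_poly_single lookup_add power_add prod.distrib algebra_simps)
qed (simp add: algebra_simps)

lemma eval_poly_uminus [simp]: "eval_poly (- p) v = - eval_poly p v"
  using eval_poly_add[of p "- p" v] by (simp add: add_eq_0_iff)

lemma eval_poly_diff [simp]: "eval_poly (p - q) v = eval_poly p v - eval_poly q v"
  using eval_poly_add[of p "- q" v] by simp

lemma eval_poly_sum [simp]: "eval_poly (sum f I) v = (\<Sum>i\<in>I. eval_poly (f i) v)"
  by (induction I rule: infinite_finite_induct) auto

lemma eval_poly_Const [simp]: "eval_poly (Const c) v = c"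
  by (simp add: Const_def eval_poly_single)

lemma eval_poly_1 [simp]: "eval_poly 1 v = 1"
  using eval_poly_Const[of 1 v] by (simp add: Const_def)

lemma eval_poly_prod_list [simp]: "eval_poly (prod_list ps) v = (\<Prod>p\<leftarrow>ps. eval_poly p v)"
  by (induction ps) auto

lemma eval_poly_Var [simp]: "eval_poly (Var i) v = v $ i"
proof -
  have "(\<Prod>j\<in>UNIV. (v $ j) ^ lookup (Poly_Mapping.single i 1) j) = (\<Prod>j\<in>UNIV. if j = i then v $ j else 1)"
    by (intro prod.cong) (auto simp: lookup_single)
  then show ?thesis by (simp add: Var_def eval_poly_single)
qed

lemma eval_poly_linear_form [simp]: "eval_poly (linear_form a) v = (\<Sum>i\<in>UNIV. a $ i * v $ i)"
  by (simp add: linear_form_def)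

section \<open>Partial derivatives and the action of derivations\<close>

lemma partial_deriv_superset:
  assumes "finite K" and "keys p \<subseteq> K"
  shows "partial_deriv i p = (\<Sum>m\<in>K. Poly_Mapping.single (m - Poly_Mapping.single i 1)
           (of_nat (lookup m i) * lookup p m))"
  unfolding partial_deriv_def using assms
  by (intro sum.mono_neutral_left) (auto simp: in_keys_iff)

lemma partial_deriv_single: "partial_deriv i (Poly_Mapping.single m c) =
    Poly_Mapping.single (m - Poly_Mapping.single i 1) (of_nat (lookup m i) * c)"
  by (subst partial_deriv_superset[of "{m}"]) auto

lemma partial_deriv_add: "partial_deriv i (p + q) = partial_deriv i p + partial_deriv i q"
  using keys_add[of p q]
  by (subst (1 2 3) partial_deriv_superset[of "keys p \<union> keys q"])
    (auto simp: lookup_add algebra_simps single_add sum.distrib)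

lemma partial_deriv_mult:
  "partial_deriv i (p * q) = partial_deriv i p * q + p * partial_deriv i q"
proof (induction p rule: mpoly_induct)
  case (single m c)
  show ?case
  proof (induction q rule: mpoly_induct)
    case (single n d)
    \<comment> \<open>If \<open>i\<close> does not occur in \<open>m\<close>, truncation may make
      the two exponents differ, but then the coefficient is 0.\<close>
    have 1: "Poly_Mapping.single (m + n - Poly_Mapping.single i 1) (of_nat (lookup m i) * (c * d)) =
        Poly_Mapping.single (m - Poly_Mapping.single i 1 + n) (of_nat (lookup m i) * (c * d))" for m n c d
    proof (cases "lookup m i = 0")
      case False
      then have "m + n - Poly_Mapping.single i 1 = m - Poly_Mapping.single i 1 + n"
        by (intro poly_mapping_eqI) (auto simp: lookup_add lookup_minus lookup_single when_def)
      then show ?thesis by simp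
    qed simp
    show ?case
      using 1[of m n c d] 1[of n m d c]
      by (simp add: mult_single partial_deriv_single lookup_add algebra_simps single_add)
  qed (simp add: algebra_simps partial_deriv_add)
qed (simp add: algebra_simps partial_deriv_add)

lemma apply_der_add: "apply_der \<theta> (p + q) = apply_der \<theta> p + apply_der \<theta> q"
  by (simp add: apply_der_def partial_deriv_add algebra_simps sum.distrib)

lemma apply_der_mult: "apply_der \<theta> (p * q) = apply_der \<theta> p * q + p * apply_der \<theta> q"
  by (simp add: apply_der_def partial_deriv_mult algebra_simps sum.distrib sum_distrib_left)

lemma apply_der_plus: "apply_der (\<theta> + \<eta>) p = apply_der \<theta> p + apply_der \<eta> p"
  by (simp add: apply_der_def algebra_simps sum.distrib)

lemma apply_der_smult: "apply_der (c *s \<theta>) p = c * apply_der \<theta> p"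
  by (simp add: apply_der_def algebra_simps sum_distrib_left)

lemma apply_der_0 [simp]: "apply_der 0 p = 0" "apply_der \<theta> 0 = 0"
  by (simp_all add: apply_der_def partial_deriv_def)

lemma apply_der_Const [simp]: "apply_der \<theta> (Const c) = 0"
  by (simp add: apply_der_def Const_def partial_deriv_single)

lemma apply_der_1 [simp]: "apply_der \<theta> 1 = 0"
  using apply_der_Const[of \<theta> 1] by (simp add: Const_def)

lemma apply_der_Var [simp]: "apply_der \<theta> (Var i) = \<theta> $ i"
proof -
  have "partial_deriv j (Var i) = (if j = i then 1 else 0)" for j
    by (auto simp: Var_def partial_deriv_single lookup_single)
  then have "apply_der \<theta> (Var i) = (\<Sum>j\<in>UNIV. \<theta> $ j * (if j = i then 1 else 0))"
    unfolding apply_der_def by presburger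
  then show ?thesis by (simp add: if_distrib cong: if_cong)
qed

lemma apply_der_sum: "apply_der \<theta> (sum f I) = (\<Sum>i\<in>I. apply_der \<theta> (f i))"
  by (induction I rule: infinite_finite_induct) (auto simp: apply_der_add)

lemma apply_der_linear_form: "apply_der \<theta> (linear_form a) = (\<Sum>i\<in>UNIV. Const (a $ i) * \<theta> $ i)"
  by (simp add: linear_form_def apply_der_sum apply_der_mult)

lemma Const_add: "Const (c + d) = Const c + Const d"
  by (simp add: Const_def single_add)

lemma Const_mult: "Const (c * d) = Const c * Const d"
  by (simp add: Const_def mult_single)

lemma Const_0 [simp]: "Const 0 = 0" and Const_1 [simp]: "Const 1 = 1"
  by (simp_all add: Const_def)

lemma Const_sum: "Const (sum f I) = (\<Sum>i\<in>I. Const (f i))"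
  by (induction I rule: infinite_finite_induct) (auto simp: Const_add)

lemma lookup_Const_mult: "lookup (Const c * p) m = c * lookup p m"
proof (induction p rule: mpoly_induct)
  case (single n d)
  show ?case by (auto simp: Const_def mult_single lookup_single when_def)
qed (simp add: algebra_simps lookup_add)

lemma Const_numeral [simp]: "Const (numeral k) = numeral k"
  by (simp add: Const_def)

lemma Const_uminus: "Const (- c) = - Const c"
  by (simp add: Const_def single_uminus)

section \<open>Homogeneous components\<close>

definition mdeg :: "('n::finite \<Rightarrow>\<^sub>0 nat) \<Rightarrow> nat" where
  "mdeg m = (\<Sum>i\<in>UNIV. lookup m i)"

lemma mdeg_add [simp]: "mdeg (m + n) = mdeg m + mdeg n"
  by (simp add: mdeg_def lookup_add sum.distrib)

lemma mdeg_single [simp]: "mdeg (Poly_Mapping.single i k) = k"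
  by (simp add: mdeg_def lookup_single when_def)

lemma mdeg_0 [simp]: "mdeg 0 = 0"
  by (simp add: mdeg_def)

lemma homogeneous_poly_iff: "homogeneous_poly d p \<longleftrightarrow> (\<forall>m. lookup p m \<noteq> 0 \<longrightarrow> mdeg m = d)"
  by (auto simp: homogeneous_poly_def mdeg_def in_keys_iff)

lemma homogeneous_poly_0 [simp]: "homogeneous_poly d 0"
  by (simp add: homogeneous_poly_iff)

lemma homogeneous_poly_add: "homogeneous_poly d p \<Longrightarrow> homogeneous_poly d q \<Longrightarrow> homogeneous_poly d (p + q)"
  by (auto simp: homogeneous_poly_iff lookup_add) (metis add.right_neutral)

lemma homogeneous_poly_uminus: "homogeneous_poly d p \<Longrightarrow> homogeneous_poly d (- p)"
  by (auto simp: homogeneous_poly_iff)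

lemma homogeneous_poly_diff: "homogeneous_poly d p \<Longrightarrow> homogeneous_poly d q \<Longrightarrow> homogeneous_poly d (p - q)"
  using homogeneous_poly_add[of d p "- q"] homogeneous_poly_uminus[of d q] by simp

lemma homogeneous_poly_sum: "(\<And>i. i \<in> I \<Longrightarrow> homogeneous_poly d (f i)) \<Longrightarrow> homogeneous_poly d (sum f I)"
  by (induction I rule: infinite_finite_induct) (auto simp: homogeneous_poly_add)

lemma homogeneous_poly_single [simp]: "mdeg m = d \<Longrightarrow> homogeneous_poly d (Poly_Mapping.single m c)"
  by (auto simp: homogeneous_poly_iff lookup_single when_def)

lemma homogeneous_poly_Const [simp]: "homogeneous_poly 0 (Const c)"
  by (simp add: Const_def)

lemma homogeneous_poly_1 [simp]: "homogeneous_poly 0 1"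
  using homogeneous_poly_Const[of 1] by simp

lemma homogeneous_poly_Var [simp]: "homogeneous_poly 1 (Var i)"
  by (simp add: Var_def)

lemma homogeneous_poly_mult:
  assumes "homogeneous_poly d p" and "homogeneous_poly e q"
  shows "homogeneous_poly (d + e) (p * q)"
proof -
  have "\<exists>a b. m = a + b \<and> a \<in> keys p \<and> b \<in> keys q" if "m \<in> keys (p * q)" for m
    using that keys_mult[of p q] by blast
  then show ?thesis using assms
    by (fastforce simp: homogeneous_poly_iff in_keys_iff)
qed

lemma homogeneous_poly_linear_form [simp]: "homogeneous_poly 1 (linear_form a)"
  unfolding linear_form_def
  using homogeneous_poly_mult[OF homogeneous_poly_Const homogeneous_poly_Var]
  by (intro homogeneous_poly_sum) simp

lemma homogeneous_prod_list:
  "(\<And>p. p \<in> set ps \<Longrightarrow> homogeneous_poly 1 p) \<Longrightarrow> homogeneous_poly (length ps) (prod_list ps)"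
proof (induction ps)
  case (Cons p ps)
  then show ?case using homogeneous_poly_mult[of 1 p "length ps" "prod_list ps"] by simp
qed simp

text \<open>In degree 0 the truncated \<open>d - 1\<close> does no harm, because the derivative is
  0.\<close>

lemma homogeneous_partial_deriv:
  assumes "homogeneous_poly d p"
  shows "homogeneous_poly (d - 1) (partial_deriv i p)"
proof -
  have "homogeneous_poly (d - 1) (Poly_Mapping.single (m - Poly_Mapping.single i 1)
          (of_nat (lookup m i) * lookup p m))" if "m \<in> keys p" for m
  proof (cases "lookup m i = 0")
    case False
    then have "m = (m - Poly_Mapping.single i 1) + Poly_Mapping.single i 1"
      by (intro poly_mapping_eqI) (auto simp: lookup_add lookup_minus lookup_single when_def)
    then have "mdeg m = mdeg (m - Poly_Mapping.single i 1) + 1"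
      by (metis mdeg_add mdeg_single)
    moreover have "mdeg m = d" using that assms by (simp add: homogeneous_poly_iff in_keys_iff)
    ultimately show ?thesis by (intro homogeneous_poly_single) simp
  qed simp
  then show ?thesis unfolding partial_deriv_def by (intro homogeneous_poly_sum)
qed

definition homcomp :: "nat \<Rightarrow> 'n::finite mpoly \<Rightarrow> 'n mpoly" where
  "homcomp d p = (\<Sum>m | m \<in> keys p \<and> mdeg m = d. Poly_Mapping.single m (lookup p m))"

lemma lookup_homcomp: "lookup (homcomp d p) m = (if mdeg m = d then lookup p m else 0)"
  by (auto simp: homcomp_def lookup_sum lookup_single when_def in_keys_iff)

lemma homogeneous_homcomp [simp]: "homogeneous_poly d (homcomp d p)"
  by (auto simp: homogeneous_poly_iff lookup_homcomp split: if_splits)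

lemma homcomp_add: "homcomp d (p + q) = homcomp d p + homcomp d q"
  by (rule poly_mapping_eqI) (simp add: lookup_homcomp lookup_add)

lemma homcomp_0 [simp]: "homcomp d 0 = 0"
  by (rule poly_mapping_eqI) (simp add: lookup_homcomp)

lemma homcomp_sum: "homcomp d (sum f I) = (\<Sum>i\<in>I. homcomp d (f i))"
  by (induction I rule: infinite_finite_induct) (auto simp: homcomp_add)

lemma homcomp_homogeneous: "homogeneous_poly e p \<Longrightarrow> homcomp d p = (if d = e then p else 0)"
  by (rule poly_mapping_eqI) (auto simp: lookup_homcomp homogeneous_poly_iff)

text \<open>Multiplication by \<open>q\<close> shifts degrees by \<open>e\<close>. The case
  distinction prevents the truncated \<open>d - e\<close> from producing a spurious component of
  degree 0.\<close>

lemma homcomp_mult: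
  assumes "homogeneous_poly e q"
  shows "homcomp d (p * q) = (if e \<le> d then homcomp (d - e) p * q else 0)"
proof (induction p rule: mpoly_induct)
  case (single m c)
  have "homogeneous_poly (mdeg m + e) (Poly_Mapping.single m c * q)"
    by (intro homogeneous_poly_mult assms) simp
  then have "homcomp d (Poly_Mapping.single m c * q) =
      (if d = mdeg m + e then Poly_Mapping.single m c * q else 0)"
    by (rule homcomp_homogeneous)
  moreover have "homcomp k (Poly_Mapping.single m c) = (if k = mdeg m then Poly_Mapping.single m c else 0)" for k
    by (intro homcomp_homogeneous) simp
  ultimately show ?case by auto
qed (simp add: algebra_simps homcomp_add)

lemma homcomp_expansion:
  obtains N where "\<And>n. n \<ge> N \<Longrightarrow> p = (\<Sum>d<n. homcomp d p)"
proof
  \<comment> \<open>A crude bound above every single degree. All larger bounds work as well, so that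
    one of them can later serve all components of a derivation.\<close>
  define N where "N = Suc (\<Sum>m\<in>keys p. mdeg m)"
  fix n assume n: "n \<ge> N"
  show "p = (\<Sum>d<n. homcomp d p)"
  proof (rule poly_mapping_eqI)
    fix m
    have "mdeg m < n" if "m \<in> keys p"
      using member_le_sum[OF that, of mdeg] n unfolding N_def by simp
    then show "lookup p m = lookup (\<Sum>d<n. homcomp d p) m"
      by (auto simp: lookup_sum lookup_homcomp in_keys_iff)
  qed
qed

section \<open>Hyperplanes\<close>

lemma finite_Collect_one: "(\<And>s t. P s \<Longrightarrow> P t \<Longrightarrow> s = t) \<Longrightarrow> finite {t. P t}"
  by (rule finite_subset[of _ "{SOME t. P t}"]) (auto intro: someI)

text \<open>Two different parameters would put a nonzero multiple of \<open>u\<close> into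
  \<open>U\<close>, so at most one parameter is possible.\<close>

lemma finite_line_Int_subspace:
  fixes u v :: "complex ^ 'n"
  assumes "vec.subspace U" and "u \<notin> U"
  shows "finite {t. v + t *s u \<in> U}"
proof (rule finite_Collect_one)
  fix s t assume *: "v + s *s u \<in> U" "v + t *s u \<in> U"
  then have "(s - t) *s u \<in> U"
    using vec.subspace_diff[OF assms(1) *] by (simp add: vec.scale_left_diff_distrib)
  then have "inverse (s - t) *s ((s - t) *s u) \<in> U"
    by (rule vec.subspace_scale[OF assms(1)])
  then have "(inverse (s - t) * (s - t)) *s u \<in> U"
    by (simp only: vec.scale_scale)
  then show "s = t" using assms(2) by (cases "s = t") auto
qed

text \<open>Induction on the family. If the vector \<open>v\<close> found so far lies in the new
  member \<open>U\<close>, replace it by \<open>u + s *s v\<close> with \<open>u\<close> outside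
  \<open>U\<close>. No such vector lies in \<open>U\<close>, and each old member excludes at most
  one \<open>s\<close>, because it does not contain \<open>v\<close>.\<close>

lemma subspace_avoid_finite_Union:
  fixes W :: "(complex ^ 'n) set"
  assumes "finite \<U>" and "vec.subspace W"
    and "\<And>U. U \<in> \<U> \<Longrightarrow> vec.subspace U" and "\<And>U. U \<in> \<U> \<Longrightarrow> \<not> W \<subseteq> U"
  obtains w where "w \<in> W" "w \<notin> \<Union>\<U>"
proof -
  have "\<exists>w\<in>W. w \<notin> \<Union>\<U>"
    using assms
  proof (induction \<U>)
    case empty
    then show ?case using vec.subspace_0 by auto
  next
    case (insert U \<U>)
    obtain v where v: "v \<in> W" "v \<notin> \<Union>\<U>" using insert by auto
    obtain u where u: "u \<in> W" "u \<notin> U" using insert by blast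
    show ?case
    proof (cases "v \<in> U")
      case True
      have fin: "finite (\<Union>U'\<in>\<U>. {t. u + t *s v \<in> U'})"
        using insert v by (auto intro!: finite_line_Int_subspace)
      obtain s where s: "\<forall>U'\<in>\<U>. u + s *s v \<notin> U'"
        using ex_new_if_finite[OF infinite_UNIV_char_0 fin] by auto
      have "u + s *s v \<notin> U"
        using u(2) vec.subspace_diff[OF insert.prems(2)[of U], of "u + s *s v" "s *s v"]
          vec.subspace_scale[OF insert.prems(2)[of U] True, of s] by auto
      moreover have "u + s *s v \<in> W"
        using u v insert.prems by (auto intro!: vec.subspace_add vec.subspace_scale)
      ultimately show ?thesis using s by auto
    qed (use v in auto)
  qed
  then show ?thesis using that by blast
qed

lemma subspace_subset_finite_Union:
  fixes W :: "(complex ^ 'n) set"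
  assumes "finite \<U>" and "vec.subspace W" and "\<And>U. U \<in> \<U> \<Longrightarrow> vec.subspace U" and "W \<subseteq> \<Union>\<U>"
  obtains U where "U \<in> \<U>" "W \<subseteq> U"
  using subspace_avoid_finite_Union[OF assms(1-3)] assms(4) by blast

lemma subspace_kernel: "vec.subspace (kernel a)"
  by (auto simp: vec.subspace_def kernel_def algebra_simps sum.distrib simp flip: sum_distrib_left)

lemma sum_mult_axis:
  fixes f :: "'n::finite \<Rightarrow> complex"
  shows "(\<Sum>k\<in>UNIV. f k * axis i c $ k) = f i * c"
proof -
  have "(\<Sum>k\<in>UNIV. f k * axis i c $ k) = (\<Sum>k\<in>UNIV. if k = i then f k * c else 0)"
    by (intro sum.cong) (auto simp: axis_def)
  then show ?thesis by simp
qed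

lemma axis_diff_in_kernel_iff: "axis i c - axis j d \<in> kernel a \<longleftrightarrow> a $ i * c = a $ j * d"
  by (simp add: kernel_def right_diff_distrib sum_subtractf sum_mult_axis)

text \<open>The vector a_i e_j - a_j e_i lies in the kernel of \<open>a\<close>; applying
  \<open>b\<close> to it gives the 2x2 minor.\<close>

lemma kernel_subset_imp_minors:
  assumes "kernel a \<subseteq> kernel b"
  shows "a $ i * b $ j = a $ j * b $ i"
proof -
  have "axis j (a $ i) - axis i (a $ j) \<in> kernel b"
    using assms axis_diff_in_kernel_iff[of j "a $ i" i "a $ j" a] by (auto simp: mult.commute)
  then show ?thesis by (simp add: axis_diff_in_kernel_iff mult.commute)
qed

lemma kernel_subset_imp_multiple:
  assumes "kernel a \<subseteq> kernel b" and "a \<noteq> 0" and "b \<noteq> 0"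
  obtains c where "c \<noteq> 0" "b = c *s a"
proof -
  obtain i where i: "a $ i \<noteq> 0" using assms(2) by (auto simp: vec_eq_iff)
  have b: "b = (b $ i / a $ i) *s a"
    using kernel_subset_imp_minors[OF assms(1), of i] i by (simp add: vec_eq_iff field_simps)
  moreover have "b $ i / a $ i \<noteq> 0" using b assms(3) by force
  ultimately show ?thesis using that by blast
qed

lemma kernel_smult: "c \<noteq> 0 \<Longrightarrow> kernel (c *s a) = kernel a"
  by (auto simp: kernel_def mult.assoc simp flip: sum_distrib_left)

lemma kernel_subset_imp_eq:
  assumes "kernel a \<subseteq> kernel b" and "a \<noteq> 0" and "b \<noteq> 0"
  shows "kernel a = kernel b"
  using kernel_subset_imp_multiple[OF assms] kernel_smult by metis

text \<open>A hyperplane covered by the finitely many members of the other arrangement lies in one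
  of them, and then equals it. This turns a hypothesis on zero loci into an equality of
  arrangements.\<close>

lemma central_arrangement_eqI:
  assumes "central_arrangement \<A>" and "central_arrangement \<B>" and "\<Union>\<A> = \<Union>\<B>"
  shows "\<A> = \<B>"
proof -
  have "\<A> \<subseteq> \<B>" if A: "central_arrangement \<A>" and B: "central_arrangement \<B>" and "\<Union>\<A> = \<Union>\<B>" for \<A> \<B>
  proof
    fix H assume H: "H \<in> \<A>"
    then obtain a where a: "a \<noteq> 0" "H = kernel a" using A by (auto simp: central_arrangement_def)
    have sub: "vec.subspace K" if "K \<in> \<B>" for K
      using B that subspace_kernel unfolding central_arrangement_def by metis
    have "finite \<B>" using B by (simp add: central_arrangement_def)
    moreover have "H \<subseteq> \<Union>\<B>" using H that(3) by blast
    ultimately obtain K where K: "K \<in> \<B>" "H \<subseteq> K"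
      using subspace_subset_finite_Union[of \<B> H] sub a subspace_kernel by metis
    obtain b where "b \<noteq> 0" "K = kernel b" using K B by (auto simp: central_arrangement_def)
    then show "H \<in> \<B>" using a K kernel_subset_imp_eq by metis
  qed
  then show ?thesis using assms by blast
qed

section \<open>Arrangements given by a list of normal vectors\<close>

definition forms_prod :: "(complex ^ 'n::finite) list \<Rightarrow> 'n mpoly" where
  "forms_prod as = prod_list (map linear_form as)"

lemma eval_forms_prod_eq_0_iff: "eval_poly (forms_prod as) v = 0 \<longleftrightarrow> (\<exists>a\<in>set as. v \<in> kernel a)"
  by (induction as) (auto simp: forms_prod_def kernel_def)

lemma zero_locus_forms_prod: "zero_locus (forms_prod as) = (\<Union>a\<in>set as. kernel a)"
  by (auto simp: zero_locus_def eval_forms_prod_eq_0_iff)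

lemma linear_form_smult: "linear_form (c *s a) = Const c * linear_form a"
  by (simp add: linear_form_def Const_mult sum_distrib_left mult.assoc)

lemma apply_der_Const_mult: "apply_der \<theta> (Const c * p) = Const c * apply_der \<theta> p"
  by (simp add: apply_der_mult)

lemma Const_mult_eq_0_iff: "Const c * p = 0 \<longleftrightarrow> c = 0 \<or> p = 0"
proof
  assume *: "Const c * p = 0"
  have "c * lookup p m = 0" for m using lookup_Const_mult[of c p m] * by simp
  then show "c = 0 \<or> p = 0" by (auto intro!: poly_mapping_eqI)
qed auto

text \<open>The normals picked by \<open>normal_vector\<close> differ from the listed ones by
  nonzero scalars, which are collected in \<open>c\<close>. Distinct kernels ensure that the product
  over the set has as many factors as the list.\<close>

lemma defining_equation_kernels:
  assumes "0 \<notin> set as" and "distinct (map kernel as)"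
  obtains c where "c \<noteq> 0" "defining_equation (kernel ` set as) = Const c * forms_prod as"
proof -
  have "\<exists>c. c \<noteq> 0 \<and> (\<Prod>H\<in>kernel ` set as. linear_form (normal_vector H)) = Const c * prod_list (map linear_form as)"
    using assms
  proof (induction as)
    case Nil
    show ?case by (auto intro!: exI[of _ 1])
  next
    case (Cons a as)
    then obtain c where c: "c \<noteq> 0"
      "(\<Prod>H\<in>kernel ` set as. linear_form (normal_vector H)) = Const c * prod_list (map linear_form as)"
      by auto
    have a: "a \<noteq> 0" using Cons.prems by auto
    have "normal_vector (kernel a) \<noteq> 0 \<and> kernel a = kernel (normal_vector (kernel a))"
      unfolding normal_vector_def by (rule someI[of _ a]) (simp add: a)
    then obtain d where d: "d \<noteq> 0" "normal_vector (kernel a) = d *s a"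
      using kernel_subset_imp_multiple[OF equalityD1 a] by blast
    have "kernel a \<notin> kernel ` set as" using Cons.prems by auto
    then show ?case using c d
      by (intro exI[of _ "c * d"]) (auto simp: Const_mult linear_form_smult mult_ac)
  qed
  then show ?thesis using that by (auto simp: defining_equation_def forms_prod_def)
qed

lemma D0_kernels:
  assumes "0 \<notin> set as" and "distinct (map kernel as)"
  shows "D0 (kernel ` set as) = {\<theta>. apply_der \<theta> (forms_prod as) = 0}"
proof -
  obtain c where "c \<noteq> 0" "defining_equation (kernel ` set as) = Const c * forms_prod as"
    using defining_equation_kernels[OF assms] .
  then show ?thesis by (simp add: D0_def apply_der_Const_mult Const_mult_eq_0_iff)
qed

lemma central_arrangement_kernels: "0 \<notin> set as \<Longrightarrow> central_arrangement (kernel ` set as)"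
  by (simp add: central_arrangement_def) metis

section \<open>Finite generation of graded submodules\<close>

text \<open>Some subsequence is monotone. If it is decreasing, it stays at its least value from some
  index on, and that constant tail is nondecreasing.\<close>

lemma nat_nondecreasing_subsequence:
  fixes s :: "nat \<Rightarrow> nat"
  obtains h where "strict_mono h" "incseq (\<lambda>n. s (h n))"
proof -
  obtain h where h: "strict_mono h" "monoseq (\<lambda>n. s (h n))"
    using seq_monosub by blast
  show ?thesis
  proof (cases "incseq (\<lambda>n. s (h n))")
    case False
    then have dec: "s (h n) \<le> s (h m)" if "m \<le> n" for m n
      using h(2) that by (auto simp: monoseq_def incseq_def)
    define v where "v = (LEAST v. v \<in> range (\<lambda>n. s (h n)))"
    have "v \<in> range (\<lambda>n. s (h n))" unfolding v_def by (rule LeastI) (rule rangeI)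
    then obtain k where k: "s (h k) = v" by blast
    have "s (h n) = v" if "n \<ge> k" for n
      using dec[OF that] k Least_le[of "\<lambda>v. v \<in> range (\<lambda>n. s (h n))" "s (h n)"]
      by (simp add: v_def)
    then have "incseq (\<lambda>n. s (h (n + k)))" by (simp add: incseq_def)
    moreover have "strict_mono (\<lambda>n. h (n + k))" using h(1) by (simp add: strict_mono_def)
    ultimately show ?thesis using that by blast
  qed (use h that in blast)
qed

lemma nondecreasing_subsequence:
  fixes f :: "nat \<Rightarrow> 'n \<Rightarrow> nat"
  assumes "finite I"
  shows "\<exists>g. strict_mono g \<and> (\<forall>i\<in>I. incseq (\<lambda>n. f (g n) i))"
  using assms
proof induction
  case empty
  show ?case by (auto intro!: exI[of _ id] simp: strict_mono_def)
next
  case (insert i I)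
  then obtain g where g: "strict_mono g" "\<forall>i\<in>I. incseq (\<lambda>n. f (g n) i)" by blast
  obtain h where h: "strict_mono h" "incseq (\<lambda>n. f (g (h n)) i)"
    using nat_nondecreasing_subsequence[of "\<lambda>n. f (g n) i"] .
  have "incseq (\<lambda>n. f (g (h n)) j)" if "j \<in> I" for j
    using g(2) that strict_mono_mono[OF h(1)] by (auto simp: incseq_def mono_def)
  moreover have "strict_mono (\<lambda>n. g (h n))" using g(1) h(1) by (simp add: strict_mono_def)
  ultimately show ?case using h(2) by (intro exI[of _ "\<lambda>n. g (h n)"]) auto
qed

text \<open>\<open>B\<close> consists of the monomials minimal under divisibility. Infinitely many
  of them would contain a sequence of distinct ones nondecreasing in every exponent, so that one
  would divide another. Descent on the degree leads from any monomial of \<open>L\<close> to a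
  minimal divisor.\<close>

lemma Dickson:
  fixes L :: "('n::finite \<Rightarrow>\<^sub>0 nat) set"
  obtains B where "finite B" "B \<subseteq> L" "\<And>m. m \<in> L \<Longrightarrow> \<exists>b\<in>B. \<exists>t. m = b + t"
proof
  define B where "B = {b \<in> L. \<forall>m\<in>L. (\<forall>i. lookup m i \<le> lookup b i) \<longrightarrow> m = b}"
  show "B \<subseteq> L" by (auto simp: B_def)
  show "finite B"
  proof (rule ccontr)
    assume "infinite B"
    then obtain f :: "nat \<Rightarrow> _" where f: "inj f" "range f \<subseteq> B"
      using infinite_countable_subset by blast
    obtain g where g: "strict_mono g" "\<forall>i\<in>UNIV. incseq (\<lambda>n. lookup (f (g n)) i)"
      using nondecreasing_subsequence[of UNIV "\<lambda>n. lookup (f n)"] by auto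
    then have "lookup (f (g 0)) i \<le> lookup (f (g 1)) i" for i
      by (auto dest!: spec[of _ i] simp: incseq_def)
    moreover have "f (g 0) \<in> L" "f (g 1) \<in> B" using f(2) by (auto simp: B_def)
    ultimately have "f (g 0) = f (g 1)" by (auto simp: B_def)
    then have "g 0 = g 1" using f(1) by (simp add: inj_eq)
    moreover have "g 0 < g 1" using g(1) by (simp add: strict_mono_def)
    ultimately show False by simp
  qed
  show "\<exists>b\<in>B. \<exists>t. m = b + t" if "m \<in> L" for m
    using that
  proof (induction "mdeg m" arbitrary: m rule: less_induct)
    case less
    show ?case
    proof (cases "m \<in> B")
      case True
      then show ?thesis by (metis add.right_neutral)
    next
      case False
      then obtain n where n: "n \<in> L" "n \<noteq> m" "\<And>i. lookup n i \<le> lookup m i"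
        using less.prems by (auto simp: B_def)
      have m: "m = n + (m - n)"
        using n(3) by (intro poly_mapping_eqI) (simp add: lookup_add lookup_minus)
      have "mdeg (m - n) \<noteq> 0"
      proof
        assume "mdeg (m - n) = 0"
        then have "m - n = 0" by (intro poly_mapping_eqI) (auto simp: mdeg_def)
        then show False using m n(2) by simp
      qed
      then have "mdeg n < mdeg m" by (subst m) simp
      then obtain b t where "b \<in> B" "n = b + t" using less.hyps n(1) by blast
      then show ?thesis using m by (metis add.assoc)
    qed
  qed
qed

lemma finite_mdeg: "finite {m :: 'n::finite \<Rightarrow>\<^sub>0 nat. mdeg m = d}"
proof (rule finite_imageD)
  have le: "lookup m i \<le> mdeg m" for m :: "'n \<Rightarrow>\<^sub>0 nat" and i
    unfolding mdeg_def by (rule member_le_sum) auto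
  have "lookup ` {m :: 'n \<Rightarrow>\<^sub>0 nat. mdeg m = d} \<subseteq> (UNIV \<rightarrow>\<^sub>E {..d})"
    by (auto simp: PiE_iff le)
  then show "finite (lookup ` {m :: 'n \<Rightarrow>\<^sub>0 nat. mdeg m = d})"
    by (rule finite_subset) (intro finite_PiE, auto)
qed (simp add: inj_on_def)

text \<open>Position over term: the last nonzero component decides first, then its largest monomial
  in the linear order on exponent maps. The order on the index type enters both comparisons.\<close>

definition leading_term :: "'n::{finite,linorder} der \<Rightarrow> 'n \<Rightarrow> ('n \<Rightarrow>\<^sub>0 nat) \<Rightarrow> bool" where
  "leading_term \<theta> i m \<longleftrightarrow> lookup (\<theta> $ i) m \<noteq> 0 \<and> (\<forall>n. lookup (\<theta> $ i) n \<noteq> 0 \<longrightarrow> n \<le> m) \<and> (\<forall>j>i. \<theta> $ j = 0)"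

lemma ex_leading_term:
  assumes "\<theta> \<noteq> 0"
  obtains i m where "leading_term \<theta> i m"
proof -
  have ne: "{i. \<theta> $ i \<noteq> 0} \<noteq> {}" using assms by (auto simp: vec_eq_iff)
  define i where "i = Max {i. \<theta> $ i \<noteq> 0}"
  have i: "\<theta> $ i \<noteq> 0" using Max_in[OF _ ne] by (simp add: i_def)
  have i': "\<theta> $ j = 0" if "j > i" for j
    using Max_ge[of "{i. \<theta> $ i \<noteq> 0}" j] that by (fastforce simp: i_def)
  have ne: "keys (\<theta> $ i) \<noteq> {}" using i by simp
  have "leading_term \<theta> i (Max (keys (\<theta> $ i)))"
    using Max_in[OF finite_keys ne] i' by (auto simp: leading_term_def simp flip: in_keys_iff)
  then show ?thesis by (rule that)
qed

section \<open>Division by leading terms\<close>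

lemma lookup_single_mult: "lookup (Poly_Mapping.single t c * p) (b + t) = c * lookup p b"
  for p :: "'n mpoly"
proof (induction p rule: mpoly_induct)
  case (single n d)
  show ?case by (auto simp: mult_single lookup_single when_def add.commute[of t])
qed (simp add: algebra_simps lookup_add)

lemma lookup_single_mult_neq_0:
  fixes p :: "'n mpoly"
  assumes "lookup (Poly_Mapping.single t c * p) m \<noteq> 0"
  obtains b where "m = b + t" "lookup p b \<noteq> 0"
proof -
  have "m \<in> keys (Poly_Mapping.single t c * p)" using assms by (simp add: in_keys_iff)
  then obtain a b where "m = a + b" "a \<in> keys (Poly_Mapping.single t c)" "b \<in> keys p"
    using keys_mult by blast
  then show ?thesis using that[of b] by (auto simp: in_keys_iff lookup_single when_def add.commute split: if_splits)
qed

lemma homogeneous_der_diff: "homogeneous_der d \<theta> \<Longrightarrow> homogeneous_der d \<eta> \<Longrightarrow> homogeneous_der d (\<theta> - \<eta>)"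
  by (simp add: homogeneous_der_def homogeneous_poly_diff)

lemma homogeneous_der_smult:
  "homogeneous_poly d p \<Longrightarrow> homogeneous_der e \<theta> \<Longrightarrow> homogeneous_der (d + e) (p *s \<theta>)"
  by (simp add: homogeneous_der_def homogeneous_poly_mult)

lemma leading_term_mdeg: "homogeneous_der d \<theta> \<Longrightarrow> leading_term \<theta> i m \<Longrightarrow> mdeg m = d"
  by (auto simp: homogeneous_der_def leading_term_def homogeneous_poly_iff)

text \<open>One division step: \<open>p\<close> is the monomial \<open>t\<close> scaled by the
  quotient of the leading coefficients, so the leading terms cancel. The second conclusion speaks of
  any leading term because the remainder may be 0 and have none.\<close>

lemma leading_term_reduce:
  assumes "leading_term \<theta> i (b + t)" and "leading_term \<gamma> i b"
    and "homogeneous_der d \<theta>" and "homogeneous_der e \<gamma>"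
  obtains p where "homogeneous_der d (\<theta> - p *s \<gamma>)"
    "\<And>j n. leading_term (\<theta> - p *s \<gamma>) j n \<Longrightarrow> j < i \<or> j = i \<and> n < b + t"
proof
  define p where "p = Poly_Mapping.single t (lookup (\<theta> $ i) (b + t) / lookup (\<gamma> $ i) b)"
  have "mdeg b = e" "mdeg (b + t) = d" using assms leading_term_mdeg by blast+
  then have d: "d = mdeg t + e" by simp
  then show "homogeneous_der d (\<theta> - p *s \<gamma>)" using assms(3,4)
    by (auto simp: p_def intro!: homogeneous_der_diff homogeneous_der_smult)
  fix j n assume jn: "leading_term (\<theta> - p *s \<gamma>) j n"
  then have ne: "lookup ((\<theta> - p *s \<gamma>) $ j) n \<noteq> 0" by (simp add: leading_term_def)
  have j: "j \<le> i"
  proof (rule ccontr)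
    assume "\<not> j \<le> i"
    then have "\<theta> $ j = 0" "\<gamma> $ j = 0" using assms by (auto simp: leading_term_def)
    then show False using ne by simp
  qed
  have "n < b + t" if "j = i"
  proof -
    \<comment> \<open>Adding \<open>t\<close> is monotone for the order on monomials, so the
      subtracted terms do not exceed \<open>b + t\<close> either.\<close>
    have "n \<le> b + t"
    proof (cases "lookup (\<theta> $ i) n = 0")
      case True
      then have "lookup (p * \<gamma> $ i) n \<noteq> 0" using ne that by (simp add: lookup_minus)
      then obtain a where "n = a + t" "lookup (\<gamma> $ i) a \<noteq> 0"
        unfolding p_def by (rule lookup_single_mult_neq_0)
      then show ?thesis using assms(2) by (auto simp: leading_term_def add_right_mono)
    qed (use assms(1) in \<open>auto simp: leading_term_def\<close>)
    moreover have "lookup ((\<theta> - p *s \<gamma>) $ i) (b + t) = 0"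
      using assms(2) by (simp add: p_def lookup_minus lookup_single_mult leading_term_def)
    ultimately show ?thesis using ne that by (metis order_le_less)
  qed
  then show "j < i \<or> j = i \<and> n < b + t" using j by force
qed

definition homcomp_der :: "nat \<Rightarrow> 'n::finite der \<Rightarrow> 'n der" where
  "homcomp_der d \<theta> = (\<chi> i. homcomp d (\<theta> $ i))"

lemma homogeneous_homcomp_der: "homogeneous_der d (homcomp_der d \<theta>)"
  by (simp add: homogeneous_der_def homcomp_der_def)

lemma homcomp_der_expansion:
  obtains N where "\<theta> = (\<Sum>d<N. homcomp_der d \<theta>)"
proof -
  have "\<exists>N. \<forall>n\<ge>N. \<theta> $ i = (\<Sum>d<n. homcomp d (\<theta> $ i))" for i
    using homcomp_expansion[of "\<theta> $ i"] by metis
  then obtain N where N: "\<And>i n. n \<ge> N i \<Longrightarrow> \<theta> $ i = (\<Sum>d<n. homcomp d (\<theta> $ i))" by metis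
  have "\<theta> $ i = (\<Sum>d<Max (range N). homcomp d (\<theta> $ i))" for i
    by (rule N) simp
  then have "\<theta> = (\<Sum>d<Max (range N). homcomp_der d \<theta>)"
    unfolding vec_eq_iff sum_component homcomp_der_def by simp
  then show ?thesis by (rule that)
qed

text \<open>\<open>G\<close> is a Groebner basis: for each position, Dickson's lemma gives finitely
  many leading monomials that divide all others, and \<open>G\<close> collects homogeneous elements
  realising them. Homogeneous elements of \<open>M\<close> reduce to 0 modulo \<open>G\<close>; the
  others are sums of components that stay in \<open>M\<close>.\<close>

theorem graded_submodule_finitely_generated:
  fixes M :: "'n::{finite,linorder} der set"
  assumes M: "Der.subspace M" and graded: "\<And>d \<theta>. \<theta> \<in> M \<Longrightarrow> homcomp_der d \<theta> \<in> M"
  obtains G where "finite G" "Der.span G = M" "\<And>\<theta>. \<theta> \<in> G \<Longrightarrow> \<exists>d. homogeneous_der d \<theta>"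
proof -
  define L where "L i = {m. \<exists>\<theta>\<in>M. (\<exists>d. homogeneous_der d \<theta>) \<and> leading_term \<theta> i m}" for i
  have "\<exists>B. finite B \<and> B \<subseteq> L i \<and> (\<forall>m\<in>L i. \<exists>b\<in>B. \<exists>t. m = b + t)" for i
    using Dickson[of "L i"] by metis
  then obtain B where B: "\<And>i. finite (B i)" "\<And>i. B i \<subseteq> L i"
      "\<And>i m. m \<in> L i \<Longrightarrow> \<exists>b\<in>B i. \<exists>t. m = b + t"
    by metis
  have "\<forall>i b. b \<in> B i \<longrightarrow> (\<exists>\<gamma>\<in>M. (\<exists>d. homogeneous_der d \<gamma>) \<and> leading_term \<gamma> i b)"
    using B(2) by (fastforce simp: L_def)
  then obtain g where g: "\<And>i b. b \<in> B i \<Longrightarrow> g i b \<in> M \<and> (\<exists>d. homogeneous_der d (g i b)) \<and> leading_term (g i b) i b"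
    by metis
  define G where "G = (\<Union>i. g i ` B i)"
  \<comment> \<open>The termination measure. Reduction preserves the degree, and in a fixed degree
    there are only finitely many leading terms.\<close>
  define smaller where "smaller i m = {(j, n). mdeg n = mdeg m \<and> (j < i \<or> j = i \<and> n < m)}"
    for i :: 'n and m :: "'n \<Rightarrow>\<^sub>0 nat"
  have fin: "finite (smaller i m)" for i m
    by (rule finite_subset[of _ "UNIV \<times> {n. mdeg n = mdeg m}"])
      (auto simp: smaller_def intro!: finite_cartesian_product finite_mdeg)
  have hom: "\<theta> \<in> Der.span G" if "\<theta> \<in> M" "homogeneous_der d \<theta>" "\<theta> = 0 \<or> leading_term \<theta> i m" for \<theta> d i m
    using that
  proof (induction "card (smaller i m)" arbitrary: \<theta> i m rule: less_induct)
    case less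
    show ?case
    proof (cases "\<theta> = 0")
      case False
      then have lt: "leading_term \<theta> i m" using less.prems by blast
      then have "m \<in> L i" using less.prems by (auto simp: L_def)
      then obtain b t where b: "b \<in> B i" "m = b + t" using B(3) by blast
      then obtain e where e: "homogeneous_der e (g i b)" using g by blast
      obtain p where p: "homogeneous_der d (\<theta> - p *s g i b)"
        "\<And>j n. leading_term (\<theta> - p *s g i b) j n \<Longrightarrow> j < i \<or> j = i \<and> n < m"
        using leading_term_reduce[of \<theta> i b t "g i b" d e] lt b e g less.prems(2) by metis
      have gG: "g i b \<in> Der.span G" using b by (intro Der.span_base) (auto simp: G_def)
      have inM: "\<theta> - p *s g i b \<in> M"
        using less.prems(1) g[OF b(1)] M by (intro Der.subspace_diff Der.subspace_scale) auto
      have "\<theta> - p *s g i b \<in> Der.span G"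
      proof (cases "\<theta> - p *s g i b = 0")
        case True
        then show ?thesis by (simp add: Der.span_zero)
      next
        case False
        then obtain j n where jn: "leading_term (\<theta> - p *s g i b) j n" by (rule ex_leading_term)
        then have "mdeg n = mdeg m"
          using p(1) less.prems(2) lt leading_term_mdeg by metis
        then have "smaller j n \<subset> smaller i m"
          using p(2)[OF jn] by (auto simp: smaller_def)
        then have "card (smaller j n) < card (smaller i m)" by (rule psubset_card_mono[OF fin])
        then show ?thesis using less.hyps p(1) inM jn by blast
      qed
      then have "(\<theta> - p *s g i b) + p *s g i b \<in> Der.span G"
        using gG by (intro Der.span_add Der.span_scale)
      then show ?thesis by simp
    qed (simp add: Der.span_zero)
  qed
  have "\<theta> \<in> Der.span G" if "\<theta> \<in> M" for \<theta>
  proof -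
    have "homcomp_der d \<theta> \<in> Der.span G" for d
      using hom[OF graded[OF that] homogeneous_homcomp_der] ex_leading_term by metis
    moreover obtain N where "\<theta> = (\<Sum>d<N. homcomp_der d \<theta>)" by (rule homcomp_der_expansion)
    ultimately show ?thesis by (metis Der.span_sum)
  qed
  moreover have "Der.span G \<subseteq> M"
    using g M by (intro Der.span_minimal) (auto simp: G_def)
  moreover have "finite G" using B(1) by (simp add: G_def)
  moreover have "\<exists>d. homogeneous_der d \<theta>" if "\<theta> \<in> G" for \<theta>
    using that g by (auto simp: G_def)
  ultimately show ?thesis using that by blast
qed

text \<open>A spanning subset of least cardinality has no proper spanning subset; sorting it by a
  choice of degrees yields the sequence.\<close>

lemma degree_sequence_exists:
  assumes "finite G" and "Der.span G = M" and hom: "\<And>\<theta>. \<theta> \<in> G \<Longrightarrow> \<exists>d. homogeneous_der d \<theta>"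
  obtains ds where "degree_sequence M ds"
proof -
  define P where "P G' \<longleftrightarrow> G' \<subseteq> G \<and> Der.span G' = M" for G'
  obtain G' where G': "P G'" "\<And>H. P H \<Longrightarrow> card G' \<le> card H"
    using ex_has_least_nat[of P G card] assms by (auto simp: P_def)
  have fin: "finite G'" using G'(1) assms(1) finite_subset by (auto simp: P_def)
  have min: "minimal_generators M G'"
    unfolding minimal_generators_def
  proof (intro conjI allI impI)
    show "Der.span G' = M" using G'(1) by (simp add: P_def)
    fix H assume "H \<subset> G'"
    then have "card H < card G'" "H \<subseteq> G" using fin G'(1) by (auto simp: psubset_card_mono P_def)
    then show "Der.span H \<noteq> M" using G'(2)[of H] by (auto simp: P_def)
  qed
  obtain xs where xs: "set xs = G'" "distinct xs" using finite_distinct_list[OF fin] by blast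
  obtain f where f: "\<And>\<theta>. \<theta> \<in> G' \<Longrightarrow> homogeneous_der (f \<theta>) \<theta>"
    using hom G'(1) unfolding P_def by (metis subsetD)
  have "degree_sequence M (map f (sort_key f xs))"
    unfolding degree_sequence_def
    using xs min f by (intro conjI exI[of _ "sort_key f xs"])
      (auto simp: list_all2_map1 list_all2_same)
  then show ?thesis by (rule that)
qed

lemma subspace_annihilator: "Der.subspace {\<theta>. apply_der \<theta> Q = 0}"
  by (auto simp: Der.subspace_def apply_der_plus apply_der_smult)

text \<open>All partial derivatives of \<open>Q\<close> are homogeneous of degree
  \<open>k - 1\<close>, so applying derivations to \<open>Q\<close> respects the grading. This makes
  the annihilator of \<open>Q\<close> a graded submodule.\<close>

lemma apply_der_homcomp_der:
  assumes "homogeneous_poly k Q"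
  shows "apply_der (homcomp_der d \<theta>) Q = homcomp (d + (k - 1)) (apply_der \<theta> Q)"
  by (simp add: apply_der_def homcomp_der_def homcomp_sum
      homcomp_mult[OF homogeneous_partial_deriv[OF assms]])

lemma homcomp_der_annihilator:
  assumes "homogeneous_poly k Q" and "apply_der \<theta> Q = 0"
  shows "apply_der (homcomp_der d \<theta>) Q = 0"
  using assms by (simp add: apply_der_homcomp_der)

section \<open>Upper bounds for the degrees\<close>

definition eval_der :: "'n::finite der \<Rightarrow> complex ^ 'n \<Rightarrow> complex ^ 'n" where
  "eval_der \<theta> v = (\<chi> i. eval_poly (\<theta> $ i) v)"

lemma eval_der_0: "eval_der 0 v = 0"
  and eval_der_add: "eval_der (\<theta> + \<eta>) v = eval_der \<theta> v + eval_der \<eta> v"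
  and eval_der_diff: "eval_der (\<theta> - \<eta>) v = eval_der \<theta> v - eval_der \<eta> v"
  and eval_der_smult: "eval_der (p *s \<theta>) v = eval_poly p v *s eval_der \<theta> v"
  by (simp_all add: eval_der_def vec_eq_iff)

text \<open>Evaluation turns polynomial coefficients into scalars, so the dimension spanned by
  values at a point bounds the number of generators from below.\<close>

lemma eval_der_span: "\<theta> \<in> Der.span G \<Longrightarrow> eval_der \<theta> v \<in> vec.span ((\<lambda>\<gamma>. eval_der \<gamma> v) ` G)"
proof (induction rule: Der.span_induct_alt)
  case base
  then show ?case by (simp add: eval_der_0 vec.span_zero)
next
  case (step c \<gamma> \<theta>)
  then show ?case
    unfolding eval_der_add eval_der_smult
    by (blast intro: vec.span_add vec.span_scale vec.span_base)
qed

text \<open>Take the component of degree \<open>e\<close> in a representation by the generators: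
  those of larger degree contribute nothing.\<close>

lemma homogeneous_in_span_of_low_degree:
  fixes \<theta> :: "'n::finite der"
  assumes hom: "list_all2 homogeneous_der ds \<theta>s" and "\<theta> \<in> Der.span (set \<theta>s)" and "homogeneous_der e \<theta>"
  shows "\<theta> \<in> Der.span {\<theta>s ! i | i. i < length \<theta>s \<and> ds ! i \<le> e}"
proof -
  let ?G = "{\<theta>s ! i | i. i < length \<theta>s \<and> ds ! i \<le> e}"
  have "homcomp_der e \<theta> \<in> Der.span ?G" using assms(2)
  proof (induction rule: Der.span_induct_alt)
    case base
    have "homcomp_der e (0 :: 'n der) = 0" by (simp add: homcomp_der_def vec_eq_iff)
    then show ?case by (simp add: Der.span_zero)
  next
    case (step c \<gamma> \<theta>)
    then obtain i where i: "i < length \<theta>s" "\<gamma> = \<theta>s ! i" by (metis in_set_conv_nth)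
    then have "homogeneous_der (ds ! i) \<gamma>" using hom by (simp add: list_all2_conv_all_nth)
    then have "homcomp_der e (c *s \<gamma> + \<theta>) =
        (if ds ! i \<le> e then homcomp (e - ds ! i) c *s \<gamma> + homcomp_der e \<theta> else homcomp_der e \<theta>)"
      by (auto simp: homcomp_der_def vec_eq_iff homogeneous_der_def homcomp_add homcomp_mult[of "ds ! i"])
    moreover have "\<gamma> \<in> Der.span ?G" if "ds ! i \<le> e"
      using i that by (intro Der.span_base) auto
    ultimately show ?case using step.IH by (auto intro: Der.span_add Der.span_scale)
  qed
  moreover have "homcomp_der e \<theta> = \<theta>"
    using assms(3) by (simp add: homcomp_der_def homogeneous_der_def vec_eq_iff homcomp_homogeneous[of e])
  ultimately show ?thesis by simp
qed

text \<open>The index \<open>i\<close> is zero-based, so \<open>H\<close> has at least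
  \<open>i + 1\<close> independent values at \<open>p\<close>. If the bound failed, sortedness would
  leave only the first \<open>i\<close> generators in degrees up to \<open>e\<close>; they would
  generate \<open>H\<close>, and its values would lie in a space spanned by \<open>i\<close>
  vectors.\<close>

lemma degrees_le:
  assumes "sorted ds" and hom: "list_all2 homogeneous_der ds \<theta>s"
    and H: "\<And>\<eta>. \<eta> \<in> H \<Longrightarrow> \<eta> \<in> Der.span (set \<theta>s) \<and> (\<exists>d\<le>e. homogeneous_der d \<eta>)"
    and indep: "vec.independent ((\<lambda>\<eta>. eval_der \<eta> p) ` H)" and "i < card ((\<lambda>\<eta>. eval_der \<eta> p) ` H)"
  shows "i < length ds \<and> ds ! i \<le> e"
proof (rule ccontr)
  assume neg: "\<not> (i < length ds \<and> ds ! i \<le> e)"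
  have len: "length ds = length \<theta>s" using hom by (rule list_all2_lengthD)
  let ?T = "set (take i \<theta>s)"
  have low: "{\<theta>s ! j | j. j < length \<theta>s \<and> ds ! j \<le> d} \<subseteq> ?T" if "d \<le> e" for d
  proof clarify
    fix j assume j: "j < length \<theta>s" "ds ! j \<le> d"
    have "j < i"
    proof (rule ccontr)
      assume "\<not> j < i"
      then have "i < length ds" "ds ! i \<le> ds ! j"
        using j len sorted_nth_mono[OF assms(1), of i j] by auto
      then show False using neg j that by simp
    qed
    then show "\<theta>s ! j \<in> ?T" using j(1) by (auto simp: in_set_conv_nth)
  qed
  have "H \<subseteq> Der.span ?T"
  proof
    fix \<eta> assume "\<eta> \<in> H"
    then obtain d where "d \<le> e" "homogeneous_der d \<eta>" "\<eta> \<in> Der.span (set \<theta>s)" using H by blast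
    then show "\<eta> \<in> Der.span ?T"
      using homogeneous_in_span_of_low_degree[OF hom] Der.span_mono[OF low] by blast
  qed
  then have "(\<lambda>\<eta>. eval_der \<eta> p) ` H \<subseteq> vec.span ((\<lambda>\<eta>. eval_der \<eta> p) ` ?T)"
    using eval_der_span by blast
  then have "card ((\<lambda>\<eta>. eval_der \<eta> p) ` H) \<le> card ((\<lambda>\<eta>. eval_der \<eta> p) ` ?T)"
    using vec.independent_span_bound[OF _ indep] by blast
  also have "\<dots> \<le> card ?T" by (rule card_image_le) simp
  also have "\<dots> \<le> i" using card_length[of "take i \<theta>s"] by simp
  finally show False using assms(5) by simp
qed

section \<open>Elements of the annihilator attached to points\<close>

lemma apply_der_diff: "apply_der (\<theta> - \<eta>) p = apply_der \<theta> p - apply_der \<eta> p"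
  by (simp add: apply_der_def algebra_simps sum_subtractf)

definition euler :: "'n::finite der" where
  "euler = (\<chi> i. Var i)"

definition const_der :: "complex ^ 'n::finite \<Rightarrow> 'n der" where
  "const_der v = (\<chi> i. Const (v $ i))"

lemma apply_euler_forms_prod: "apply_der euler (forms_prod as) = of_nat (length as) * forms_prod as"
proof (induction as)
  case (Cons a as)
  have "apply_der euler (linear_form a) = linear_form a"
    unfolding apply_der_linear_form by (simp add: euler_def linear_form_def)
  then show ?case using Cons by (simp add: forms_prod_def apply_der_mult algebra_simps)
qed (simp add: forms_prod_def)

lemma apply_const_der_forms_prod:
  "(\<And>a. a \<in> set as \<Longrightarrow> v \<in> kernel a) \<Longrightarrow> apply_der (const_der v) (forms_prod as) = 0"
proof (induction as)
  case (Cons a as)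
  have "apply_der (const_der v) (linear_form a) = Const (\<Sum>i\<in>UNIV. a $ i * v $ i)"
    by (simp add: apply_der_linear_form const_der_def Const_sum Const_mult)
  then show ?case using Cons by (simp add: forms_prod_def apply_der_mult kernel_def)
qed (simp add: forms_prod_def)

lemma forms_prod_filter:
  "forms_prod as = forms_prod (filter P as) * forms_prod (filter (\<lambda>a. \<not> P a) as)"
  by (induction as) (auto simp: forms_prod_def mult_ac)

lemma homogeneous_forms_prod: "homogeneous_poly (length as) (forms_prod as)"
proof -
  have "homogeneous_poly 1 p" if "p \<in> set (map linear_form as)" for p
    using that homogeneous_poly_linear_form by auto
  then show ?thesis
    using homogeneous_prod_list[of "map linear_form as"] by (simp only: forms_prod_def length_map)
qed

text \<open>
  With \<open>P\<close> the product of the forms not vanishing at \<open>v\<close>, the derivation \<open>P \<partial>\<^sub>v\<close> multiplies \<open>Q\<close> by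
  \<open>\<partial>\<^sub>v P\<close>; a multiple of the Euler derivation corrects it to an element of \<open>D\<^sub>0\<close>.
\<close>

lemma point_derivation:
  fixes as :: "(complex ^ 'n::finite) list"
  assumes "as \<noteq> []"
  obtains \<theta> where "apply_der \<theta> (forms_prod as) = 0"
    "homogeneous_der (length (filter (\<lambda>a. v \<notin> kernel a) as)) \<theta>"
    "\<And>p. eval_poly (forms_prod as) p \<noteq> 0 \<Longrightarrow> \<exists>c \<mu>. c \<noteq> 0 \<and> eval_der \<theta> p = c *s v - \<mu> *s p"
proof
  define cs where "cs = filter (\<lambda>a. v \<notin> kernel a) as"
  define P where "P = forms_prod cs"
  define R where "R = forms_prod (filter (\<lambda>a. v \<in> kernel a) as)"
  \<comment> \<open>The Euler derivation multiplies the whole product by \<open>length as\<close>;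
    this factor compensates.\<close>
  define P' where "P' = Const (1 / of_nat (length as)) * apply_der (const_der v) P"
  define \<theta> where "\<theta> = P *s const_der v - P' *s euler"
  have Q: "forms_prod as = R * P" unfolding P_def R_def cs_def by (rule forms_prod_filter)
  have R: "apply_der (const_der v) R = 0"
    unfolding R_def by (rule apply_const_der_forms_prod) simp
  have *: "Const (1 / of_nat (length as)) * of_nat (length as) = (1 :: 'n mpoly)"
    using assms by (simp add: Const_def mult_single flip: single_of_nat)
  have "apply_der \<theta> (forms_prod as) =
      P * (R * apply_der (const_der v) P) - P' * (of_nat (length as) * (R * P))"
    unfolding \<theta>_def apply_der_diff apply_der_smult apply_euler_forms_prod
    by (simp add: Q apply_der_mult R)
  also have "P' * (of_nat (length as) * (R * P)) =
      (Const (1 / of_nat (length as)) * of_nat (length as)) * (apply_der (const_der v) P * (R * P))"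
    by (simp only: P'_def mult_ac)
  finally show "apply_der \<theta> (forms_prod as) = 0" unfolding * by (simp add: mult_ac)
  have P_hom: "homogeneous_poly (length cs) P" unfolding P_def by (rule homogeneous_forms_prod)
  have "homogeneous_der (length cs + 0) (P *s const_der v)"
    using P_hom by (intro homogeneous_der_smult) (simp_all add: homogeneous_der_def const_der_def)
  moreover have "homogeneous_der (length cs) (P' *s euler)"
  proof (cases "cs = []")
    \<comment> \<open>Now \<open>P\<close> is 1 and \<open>length cs - 1\<close> would truncate; the
      correction term is 0.\<close>
    case True
    then have "P' = 0" by (simp add: P'_def P_def forms_prod_def)
    then show ?thesis by (simp add: homogeneous_der_def)
  next
    case False
    have "homogeneous_poly (0 + (length cs - 1)) (Const (v $ i) * partial_deriv i P)" for i
      using homogeneous_partial_deriv[OF P_hom] by (intro homogeneous_poly_mult) auto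
    then have "homogeneous_poly (length cs - 1) (apply_der (const_der v) P)"
      by (auto simp: apply_der_def const_der_def intro!: homogeneous_poly_sum)
    then have "homogeneous_poly (0 + (length cs - 1)) P'"
      unfolding P'_def by (intro homogeneous_poly_mult) auto
    then have "homogeneous_der ((0 + (length cs - 1)) + 1) (P' *s euler)"
      by (rule homogeneous_der_smult) (use homogeneous_poly_Var in \<open>auto simp: homogeneous_der_def euler_def\<close>)
    then show ?thesis using False by simp
  qed
  ultimately show "homogeneous_der (length (filter (\<lambda>a. v \<notin> kernel a) as)) \<theta>"
    unfolding \<theta>_def cs_def by (intro homogeneous_der_diff) simp_all
  fix p assume "eval_poly (forms_prod as) p \<noteq> 0"
  then have "eval_poly P p \<noteq> 0" by (simp add: Q)
  moreover have "eval_der \<theta> p = eval_poly P p *s v - eval_poly P' p *s p"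
    by (simp add: \<theta>_def eval_der_diff eval_der_smult)
      (simp add: eval_der_def const_der_def euler_def vec_eq_iff)
  ultimately show "\<exists>c \<mu>. c \<noteq> 0 \<and> eval_der \<theta> p = c *s v - \<mu> *s p" by blast
qed

text \<open>A scalar form of independence that also excludes repeated vectors and can be decided by
  simplification for explicit ones.\<close>

definition independent3 :: "complex ^ 'n::finite \<Rightarrow> complex ^ 'n \<Rightarrow> complex ^ 'n \<Rightarrow> bool" where
  "independent3 u v w \<longleftrightarrow> (\<forall>x y z. x *s u + y *s v + z *s w = 0 \<longrightarrow> x = 0 \<and> y = 0 \<and> z = 0)"

lemma independent3:
  assumes "independent3 u v w"
  shows "vec.independent {u, v, w}" and "card {u, v, w} = 3"
proof -
  have 1: "x = 0 \<and> y = 0 \<and> z = 0" if "x *s u + y *s v + z *s w = 0" for x y z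
    using assms that by (auto simp: independent3_def)
  have ne: "u \<noteq> v" "u \<noteq> w" "v \<noteq> w"
    using 1[of 1 "-1" 0] 1[of 1 0 "-1"] 1[of 0 1 "-1"] by auto
  then show "card {u, v, w} = 3" by simp
  show "vec.independent {u, v, w}"
  proof (rule vec.independent_if_scalars_zero)
    fix f x assume "(\<Sum>x\<in>{u, v, w}. f x *s x) = 0" "x \<in> {u, v, w}"
    then show "f x = 0" using ne 1[of "f u" "f v" "f w"] by (auto simp: add.assoc)
  qed simp
qed

lemma kernel_neq_UNIV:
  assumes "a \<noteq> 0"
  shows "kernel a \<noteq> UNIV"
proof
  assume "kernel a = UNIV"
  \<comment> \<open>Here \<open>axis i 0\<close> is 0; it brings the coordinate vector into the
    shape of \<open>axis_diff_in_kernel_iff\<close>.\<close>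
  then have "axis i 1 - axis i 0 \<in> kernel a" for i by simp
  then show False using assms by (auto simp: axis_diff_in_kernel_iff vec_eq_iff simp del: axis_eq_0_iff)
qed

text \<open>The point \<open>p\<close> is taken off all hyperplanes and outside the span of the
  three vectors, which is proper as the dimension exceeds 3. Modulo \<open>p\<close>, the three
  derivations have nonzero multiples of \<open>v1\<close>, \<open>v2\<close>, \<open>v3\<close> as
  values, so these values are independent.\<close>

lemma three_points_degrees_le:
  fixes as :: "(complex ^ 'n::finite) list"
  assumes "3 < CARD('n)" and "as \<noteq> []" and "0 \<notin> set as"
    and "sorted ds" and "list_all2 homogeneous_der ds \<theta>s"
    and span: "Der.span (set \<theta>s) = {\<theta>. apply_der \<theta> (forms_prod as) = 0}"
    and indep: "independent3 v1 v2 v3"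
    and points: "\<And>v. v \<in> {v1, v2, v3} \<Longrightarrow> length (filter (\<lambda>a. v \<notin> kernel a) as) \<le> e"
    and "i < 3"
  shows "i < length ds \<and> ds ! i \<le> e"
proof -
  have "vec.dim (vec.span {v1, v2, v3}) < vec.dim (UNIV :: (complex ^ 'n) set)"
    using vec.dim_le_card'[of "{v1, v2, v3}"] independent3(2)[OF indep] assms(1)
    by (simp add: vec_dim_card del: vec.dim_UNIV)
  then have "\<not> UNIV \<subseteq> vec.span {v1, v2, v3}" by (metis less_irrefl top.extremum_uniqueI)
  moreover have "\<not> UNIV \<subseteq> kernel a" if "a \<in> set as" for a
    using kernel_neq_UNIV[of a] that assms(3) by (metis top.extremum_uniqueI)
  moreover define \<U> where "\<U> = insert (vec.span {v1, v2, v3}) (kernel ` set as)"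
  ultimately have proper: "\<not> UNIV \<subseteq> U" if "U \<in> \<U>" for U
    using that unfolding \<U>_def by blast
  have sub: "vec.subspace U" if "U \<in> \<U>" for U
    using that vec.subspace_span subspace_kernel unfolding \<U>_def by blast
  have "finite \<U>" by (simp add: \<U>_def)
  then obtain p where "p \<notin> \<Union>\<U>"
    using subspace_avoid_finite_Union[OF _ vec.subspace_UNIV sub proper] by blast
  then have p: "p \<notin> vec.span {v1, v2, v3}" "\<And>a. a \<in> set as \<Longrightarrow> p \<notin> kernel a"
    by (simp_all add: \<U>_def)
  then have Qp: "eval_poly (forms_prod as) p \<noteq> 0" by (simp add: eval_forms_prod_eq_0_iff)
  have "\<exists>\<theta> d. apply_der \<theta> (forms_prod as) = 0 \<and> d \<le> e \<and> homogeneous_der d \<theta> \<and>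
      (\<exists>c \<mu>. c \<noteq> 0 \<and> eval_der \<theta> p = c *s v - \<mu> *s p)" if "v \<in> {v1, v2, v3}" for v
    using point_derivation[OF assms(2), of v] points[OF that] Qp by metis
  then obtain \<theta> c \<mu> where \<theta>: "\<And>v. v \<in> {v1, v2, v3} \<Longrightarrow> apply_der (\<theta> v) (forms_prod as) = 0 \<and>
      (\<exists>d\<le>e. homogeneous_der d (\<theta> v)) \<and> c v \<noteq> 0 \<and> eval_der (\<theta> v) p = c v *s v - \<mu> v *s p"
    by metis
  have ind: "independent3 (eval_der (\<theta> v1) p) (eval_der (\<theta> v2) p) (eval_der (\<theta> v3) p)"
    unfolding independent3_def
  proof (intro allI impI)
    fix x y z
    assume *: "x *s eval_der (\<theta> v1) p + y *s eval_der (\<theta> v2) p + z *s eval_der (\<theta> v3) p = 0"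
    \<comment> \<open>The total coefficient of \<open>p\<close>; if it were nonzero, division by it
      would put \<open>p\<close> into the span.\<close>
    define k where "k = x * \<mu> v1 + y * \<mu> v2 + z * \<mu> v3"
    have eq: "(x * c v1) *s v1 + (y * c v2) *s v2 + (z * c v3) *s v3 = k *s p"
      using * \<theta>[of v1] \<theta>[of v2] \<theta>[of v3] by (simp add: k_def vec_eq_iff algebra_simps)
    have "k *s p \<in> vec.span {v1, v2, v3}"
      unfolding eq[symmetric] by (intro vec.span_add vec.span_scale vec.span_base) auto
    then have "inverse k *s (k *s p) \<in> vec.span {v1, v2, v3}" by (rule vec.span_scale)
    then have "(inverse k * k) *s p \<in> vec.span {v1, v2, v3}" by (simp only: vec.scale_scale)
    then have "k = 0" using p(1) by (cases "k = 0") auto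
    then show "x = 0 \<and> y = 0 \<and> z = 0"
      using eq indep[unfolded independent3_def, rule_format, of "x * c v1" "y * c v2" "z * c v3"]
        \<theta>[of v1] \<theta>[of v2] \<theta>[of v3] by auto
  qed
  show ?thesis
  proof (rule degrees_le[OF assms(4,5), of "\<theta> ` {v1, v2, v3}"])
    show "\<eta> \<in> Der.span (set \<theta>s) \<and> (\<exists>d\<le>e. homogeneous_der d \<eta>)" if "\<eta> \<in> \<theta> ` {v1, v2, v3}" for \<eta>
      using that \<theta> unfolding span by blast
    show "vec.independent ((\<lambda>\<eta>. eval_der \<eta> p) ` \<theta> ` {v1, v2, v3})"
      and "i < card ((\<lambda>\<eta>. eval_der \<eta> p) ` \<theta> ` {v1, v2, v3})"
      using independent3[OF ind] assms(9) by simp_all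
  qed
qed

section \<open>Derivations of degree two\<close>

lemma eval_poly_on_line:
  obtains P :: "complex poly" where "\<And>t. eval_poly p (v + t *s u) = poly P t"
proof -
  have "\<exists>P :: complex poly. \<forall>t. eval_poly p (v + t *s u) = poly P t"
  proof (induction p rule: mpoly_induct)
    case (single m c)
    show ?case
      by (rule exI[of _ "[:c:] * (\<Prod>i\<in>UNIV. [:v $ i, u $ i:] ^ lookup m i)"])
        (simp add: eval_poly_single poly_prod)
  next
    case (add p q)
    then obtain P Q where "\<forall>t. eval_poly p (v + t *s u) = poly P t" "\<forall>t. eval_poly q (v + t *s u) = poly Q t"
      by blast
    then show ?case by (intro exI[of _ "P + Q"]) simp
  qed
  then show ?thesis using that by blast
qed

text \<open>Write the product as alpha R. On the hyperplane of \<open>a\<close>, theta(alpha R) = 0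
  becomes theta(alpha) R = 0, so theta(alpha) vanishes off the other hyperplanes. A line through
  \<open>v\<close> inside the hyperplane, in a direction \<open>u\<close> outside the others, meets
  each of them at most once; on it theta(alpha) is a polynomial in one variable with infinitely many
  roots.\<close>

lemma annihilator_preserves_hyperplane:
  fixes as :: "(complex ^ 'n::finite) list"
  assumes "0 \<notin> set as" and dist: "distinct (map kernel as)"
    and \<theta>: "apply_der \<theta> (forms_prod as) = 0" and a: "a \<in> set as" and v: "v \<in> kernel a"
  shows "(\<Sum>i\<in>UNIV. a $ i * eval_poly (\<theta> $ i) v) = 0"
proof -
  define bs where "bs = remove1 a as"
  have "mset as = mset (a # bs)" using a by (simp add: bs_def)
  then have "mset (map linear_form as) = mset (map linear_form (a # bs))" by (metis mset_map)
  then have Q: "forms_prod as = linear_form a * forms_prod bs"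
    unfolding forms_prod_def by (metis list.simps(9) prod_list.Cons prod_mset_prod_list)
  define p where "p = apply_der \<theta> (linear_form a)"
  have vanish: "eval_poly p w = 0" if "w \<in> kernel a" "\<And>b. b \<in> set bs \<Longrightarrow> w \<notin> kernel b" for w
  proof -
    have "0 = eval_poly (apply_der \<theta> (forms_prod as)) w" by (simp add: \<theta>)
    also have "\<dots> = eval_poly p w * eval_poly (forms_prod bs) w"
      using that(1) by (simp add: Q apply_der_mult p_def kernel_def)
    finally show ?thesis using that(2) by (simp add: eval_forms_prod_eq_0_iff)
  qed
  have ne: "\<not> kernel a \<subseteq> U" if U: "U \<in> kernel ` set bs" for U
  proof
    assume *: "kernel a \<subseteq> U"
    obtain b where b: "b \<in> set bs" "U = kernel b" using U by blast
    have "distinct as" using dist by (simp add: distinct_map)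
    then have "b \<in> set as" "b \<noteq> a" using b by (auto simp: bs_def)
    moreover from this have "kernel a \<noteq> kernel b"
      using dist a by (auto simp: distinct_map inj_on_def)
    ultimately show False using kernel_subset_imp_eq[of a b] * b a assms(1) by metis
  qed
  have fin: "finite (kernel ` set bs)" by simp
  have sub: "vec.subspace U" if "U \<in> kernel ` set bs" for U
    using that subspace_kernel by blast
  obtain u where u: "u \<in> kernel a" "u \<notin> \<Union>(kernel ` set bs)"
    using subspace_avoid_finite_Union[OF fin subspace_kernel[of a] sub ne] by blast
  obtain P where P: "\<And>t. eval_poly p (v + t *s u) = poly P t"
    using eval_poly_on_line[of p v u] by blast
  have "poly P t = 0" if "t \<notin> (\<Union>b\<in>set bs. {t. v + t *s u \<in> kernel b})" for t
    using that u(1) v vanish[of "v + t *s u"]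
    by (auto simp flip: P intro: vec.subspace_add[OF subspace_kernel] vec.subspace_scale[OF subspace_kernel])
  then have "UNIV \<subseteq> {t. poly P t = 0} \<union> (\<Union>b\<in>set bs. {t. v + t *s u \<in> kernel b})" by blast
  moreover have "finite (\<Union>b\<in>set bs. {t. v + t *s u \<in> kernel b})"
    using u(2) by (intro finite_UN_I finite_line_Int_subspace[OF subspace_kernel]) auto
  moreover have "infinite (UNIV :: complex set)" by (rule infinite_UNIV_char_0)
  ultimately have "infinite {t. poly P t = 0}" by (meson finite_UnI finite_subset)
  then have "P = 0" using poly_roots_finite by blast
  then have "eval_poly p v = 0" using P[of 0] by simp
  then show ?thesis by (simp add: p_def apply_der_linear_form)
qed

section \<open>Quadrics and their symmetric matrices\<close>

abbreviation unit_exp :: "'n \<Rightarrow> 'n \<Rightarrow>\<^sub>0 nat" where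
  "unit_exp i \<equiv> Poly_Mapping.single i 1"

lemma unit_exp_add_eq_iff: "unit_exp j + unit_exp k = unit_exp a + unit_exp b \<longleftrightarrow> j = a \<and> k = b \<or> j = b \<and> k = a"
proof
  assume eq: "unit_exp j + unit_exp k = unit_exp a + unit_exp b"
  have "lookup (unit_exp j + unit_exp k) i = lookup (unit_exp a + unit_exp b) i" for i by (simp only: eq)
  from this[of j] this[of a] this[of b] show "j = a \<and> k = b \<or> j = b \<and> k = a"
    by (auto simp: lookup_add lookup_single when_def split: if_splits)
qed (auto simp: add.commute)

lemma mdeg_eq_SucE:
  assumes "mdeg m = Suc d"
  obtains i n where "m = unit_exp i + n" "mdeg n = d"
proof -
  obtain i where i: "lookup m i \<noteq> 0" using assms by (fastforce simp: mdeg_def)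
  then have m: "m = unit_exp i + (m - unit_exp i)"
    by (intro poly_mapping_eqI) (auto simp: lookup_add lookup_minus lookup_single when_def)
  then have "mdeg m = mdeg (unit_exp i) + mdeg (m - unit_exp i)" by (metis mdeg_add)
  then show ?thesis using that[OF m] assms by simp
qed

lemma mdeg_eq_2E:
  assumes "mdeg m = 2"
  obtains i j where "m = unit_exp i + unit_exp j"
proof -
  obtain i n where 1: "m = unit_exp i + n" "mdeg n = Suc 0"
    using mdeg_eq_SucE[of m 1] assms by (auto simp: numeral_2_eq_2)
  then obtain j k where 2: "n = unit_exp j + k" "mdeg k = 0" using mdeg_eq_SucE by metis
  have "k = 0" using 2(2) by (intro poly_mapping_eqI) (auto simp: mdeg_def)
  then show ?thesis using 1 2 that by simp
qed

text \<open>The symmetric matrix of the quadratic part. Off the diagonal the coefficient is halved,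
  since x_j x_k occurs twice in the double sum.\<close>

definition sym_coeff :: "'n mpoly \<Rightarrow> 'n \<Rightarrow> 'n \<Rightarrow> complex" where
  "sym_coeff p j k = (if j = k then 1 else 1 / 2) * lookup p (unit_exp j + unit_exp k)"

lemma sum_sum_delta:
  fixes f :: "'n::finite \<Rightarrow> 'n \<Rightarrow> complex"
  shows "(\<Sum>j\<in>UNIV. \<Sum>k\<in>UNIV. if j = a \<and> k = b then f j k else 0) = f a b"
proof -
  have "(\<Sum>j\<in>UNIV. \<Sum>k\<in>UNIV. if j = a \<and> k = b then f j k else 0) =
      (\<Sum>j\<in>UNIV. if j = a then (\<Sum>k\<in>UNIV. if k = b then f j k else 0) else 0)"
    by (intro sum.cong) auto
  then show ?thesis by simp
qed

text \<open>Formulated for the quadratic component of any polynomial, since homogeneity would not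
  pass to the summands in the induction.\<close>

lemma eval_homcomp_2:
  fixes p :: "'n::finite mpoly"
  shows "eval_poly (homcomp 2 p) v = (\<Sum>j\<in>UNIV. \<Sum>k\<in>UNIV. sym_coeff p j k * v $ j * v $ k)"
proof (induction p rule: mpoly_induct)
  case (single m c)
  have hom: "homcomp 2 (Poly_Mapping.single m c) = (if 2 = mdeg m then Poly_Mapping.single m c else 0)"
    by (intro homcomp_homogeneous) simp
  show ?case
  proof (cases "mdeg m = 2")
    case True
    then obtain a b where m: "m = unit_exp a + unit_exp b" by (rule mdeg_eq_2E)
    have "Poly_Mapping.single m c = Const c * (Var a * Var b)"
      by (simp add: Const_def Var_def mult_single m)
    then have "eval_poly (Poly_Mapping.single m c) v = c * v $ a * v $ b" by simp
    then have "eval_poly (homcomp 2 (Poly_Mapping.single m c)) v = c * v $ a * v $ b"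
      using True by (simp add: hom)
    also have "\<dots> = (\<Sum>j\<in>UNIV. \<Sum>k\<in>UNIV. sym_coeff (Poly_Mapping.single m c) j k * v $ j * v $ k)"
    proof (cases "a = b")
      case True
      have "(\<Sum>j\<in>UNIV. \<Sum>k\<in>UNIV. sym_coeff (Poly_Mapping.single m c) j k * v $ j * v $ k) =
          (\<Sum>j\<in>UNIV. \<Sum>k\<in>UNIV. if j = a \<and> k = a then c * v $ j * v $ k else 0)"
        using True by (intro sum.cong) (auto simp: sym_coeff_def lookup_single when_def m unit_exp_add_eq_iff simp del: One_nat_def)
      then show ?thesis using True by (simp add: sum_sum_delta)
    next
      case False
      have "(\<Sum>j\<in>UNIV. \<Sum>k\<in>UNIV. sym_coeff (Poly_Mapping.single m c) j k * v $ j * v $ k) =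
          (\<Sum>j\<in>UNIV. \<Sum>k\<in>UNIV. (if j = a \<and> k = b then c / 2 * v $ j * v $ k else 0) +
             (if j = b \<and> k = a then c / 2 * v $ j * v $ k else 0))"
        using False by (intro sum.cong) (auto simp: sym_coeff_def lookup_single when_def m unit_exp_add_eq_iff simp del: One_nat_def)
      then show ?thesis by (simp add: sum.distrib sum_sum_delta)
    qed
    finally show ?thesis .
  next
    case False
    then have "m \<noteq> unit_exp j + unit_exp k" for j k by auto
    then have "sym_coeff (Poly_Mapping.single m c) j k = 0" for j k
      by (simp add: sym_coeff_def lookup_single when_def del: One_nat_def)
    then show ?thesis using False by (simp add: hom)
  qed
qed (simp add: homcomp_add sym_coeff_def lookup_add algebra_simps sum.distrib)

text \<open>Testing at e_j and e_j + e_k with \<open>j\<close>, \<open>k\<close> different from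
  \<open>i\<close> kills all matrix entries outside row and column \<open>i\<close>. Every remaining
  term contains x_i, and the halves in \<open>sym_coeff\<close> recombine to coefficients.\<close>

lemma quadric_vanishing_on_coordinate_hyperplane:
  fixes p :: "'n::finite mpoly"
  assumes hom: "homogeneous_poly 2 p" and van: "\<And>v. v $ i = 0 \<Longrightarrow> eval_poly p v = 0"
  shows "j \<noteq> i \<Longrightarrow> k \<noteq> i \<Longrightarrow> lookup p (unit_exp j + unit_exp k) = 0"
    and "eval_poly p v = v $ i * (\<Sum>j\<in>UNIV. lookup p (unit_exp i + unit_exp j) * v $ j)"
proof -
  have ev: "eval_poly p v = (\<Sum>j\<in>UNIV. \<Sum>k\<in>UNIV. sym_coeff p j k * v $ j * v $ k)" for v
    using eval_homcomp_2[of p v] homcomp_homogeneous[OF hom, of 2] by simp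
  have sym: "sym_coeff p j k = sym_coeff p k j" for j k
    by (simp add: sym_coeff_def add.commute)
  define B where "B u w = (\<Sum>j\<in>UNIV. \<Sum>k\<in>UNIV. sym_coeff p j k * u $ j * w $ k)" for u w :: "complex ^ 'n"
  have B_axis: "B (axis j x) (axis k y) = sym_coeff p j k * x * y" for j k x y
    by (simp add: B_def sum_mult_axis flip: sum_distrib_right)
  have "eval_poly p (u + w) = B u u + B u w + B w u + B w w" for u w
    unfolding ev B_def by (simp add: algebra_simps sum.distrib)
  then have ev2: "eval_poly p (axis j x + axis k y) =
      x * x * sym_coeff p j j + 2 * x * y * sym_coeff p j k + y * y * sym_coeff p k k" for j k x y
    by (simp add: B_axis sym[of k j])
  have diag: "sym_coeff p j j = 0" if "j \<noteq> i" for j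
    using van[of "axis j 1 + axis j 0"] ev2[of j 1 j 0] that by (simp add: axis_def)
  have coeff: "sym_coeff p j k = 0" if "j \<noteq> i" "k \<noteq> i" for j k
    using van[of "axis j 1 + axis k 1"] ev2[of j 1 k 1] that by (simp add: axis_def diag)
  then show "lookup p (unit_exp j + unit_exp k) = 0" if "j \<noteq> i" "k \<noteq> i"
    using coeff[OF that] by (simp add: sym_coeff_def split: if_splits)
  have row: "(\<Sum>k\<in>UNIV. sym_coeff p j k * v $ j * v $ k) =
      (if j = i then v $ i * (\<Sum>k\<in>UNIV. sym_coeff p i k * v $ k) else sym_coeff p i j * v $ j * v $ i)" for j
  proof (cases "j = i")
    case False
    have "(\<Sum>k\<in>UNIV. sym_coeff p j k * v $ j * v $ k) =
        (\<Sum>k\<in>UNIV. if k = i then sym_coeff p j i * v $ j * v $ i else 0)"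
      using coeff[OF False] by (intro sum.cong) auto
    then show ?thesis using False by (simp add: sym)
  qed (simp add: sum_distrib_left mult_ac)
  have "eval_poly p v = v $ i * (\<Sum>k\<in>UNIV. sym_coeff p i k * v $ k) +
      (\<Sum>j\<in>UNIV-{i}. sym_coeff p i j * v $ j * v $ i)"
    unfolding ev row by (subst sum.remove[of _ i]) auto
  also have "\<dots> = v $ i * (sym_coeff p i i * v $ i + 2 * (\<Sum>j\<in>UNIV-{i}. sym_coeff p i j * v $ j))"
    by (subst sum.remove[of _ i]) (auto simp: algebra_simps sum_distrib_left)
  also have "2 * (\<Sum>j\<in>UNIV-{i}. sym_coeff p i j * v $ j) = (\<Sum>j\<in>UNIV-{i}. lookup p (unit_exp i + unit_exp j) * v $ j)"
    by (auto simp: sum_distrib_left sym_coeff_def intro!: sum.cong)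
  also have "sym_coeff p i i * v $ i + \<dots> = (\<Sum>j\<in>UNIV. lookup p (unit_exp i + unit_exp j) * v $ j)"
    by (subst (2) sum.remove[of _ i]) (auto simp: sym_coeff_def)
  finally show "eval_poly p v = v $ i * (\<Sum>j\<in>UNIV. lookup p (unit_exp i + unit_exp j) * v $ j)" .
qed

section \<open>Lower bounds for the degrees\<close>

text \<open>
  If the coordinate hyperplanes belong to the arrangement, then a quadratic derivation in \<open>D\<^sub>0\<close> has
  the form \<open>\<theta>\<^sub>i = x\<^sub>i \<Sum>\<^sub>j M\<^sub>i\<^sub>j x\<^sub>j\<close>. The numbers \<open>M\<^sub>i\<^sub>j - M\<^sub>j\<^sub>j\<close> do not change when a multiple of the
  Euler derivation is added to \<open>\<theta>\<close>.
\<close>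

definition reduced_coeff :: "'n::finite der \<Rightarrow> 'n \<Rightarrow> 'n \<Rightarrow> complex" where
  "reduced_coeff \<theta> i j = lookup (\<theta> $ i) (unit_exp i + unit_exp j) - lookup (\<theta> $ j) (unit_exp j + unit_exp j)"

text \<open>
  The linear equations in \<open>N\<close> are those imposed on \<open>reduced_coeff \<theta>\<close> by the condition that \<open>\<theta>\<close> preserves
  the hyperplanes with normals \<open>as\<close>; rigidity says that \<open>N k l\<close> determines the solution.
\<close>

definition rigid_at :: "'n \<Rightarrow> 'n \<Rightarrow> (complex ^ 'n::finite) list \<Rightarrow> bool" where
  "rigid_at k l as \<longleftrightarrow> (\<forall>N. N k l = 0 \<longrightarrow>
     (\<forall>a\<in>set as. \<forall>i j. i \<noteq> j \<longrightarrow> a $ i \<noteq> 0 \<longrightarrow> a $ j \<noteq> 0 \<longrightarrow> a $ i * N i j + a $ j * N j i = 0) \<longrightarrow>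
     (\<forall>a\<in>set as. \<forall>i i' j. a $ i \<noteq> 0 \<longrightarrow> a $ i' \<noteq> 0 \<longrightarrow> a $ j = 0 \<longrightarrow> N i j = N i' j) \<longrightarrow>
     (\<forall>i j. i \<noteq> j \<longrightarrow> N i j = 0))"

lemma apply_der_eval: "eval_poly (apply_der \<theta> p) v = (\<Sum>i\<in>UNIV. eval_poly (\<theta> $ i) v * eval_poly (partial_deriv i p) v)"
  by (simp add: apply_der_def)

lemma eval_poly_of_nat [simp]: "eval_poly (of_nat n) v = of_nat n"
  by (induction n) auto

locale quadratic_derivation =
  fixes as :: "(complex ^ 'n::finite) list" and \<theta> :: "'n der"
  assumes nz: "0 \<notin> set as" and dist: "distinct (map kernel as)"
    and axes: "axis i 1 \<in> set as"
    and annihilates: "apply_der \<theta> (forms_prod as) = 0" and hom: "homogeneous_der 2 \<theta>"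
begin

definition M :: "'n \<Rightarrow> 'n \<Rightarrow> complex" where
  "M i j = lookup (\<theta> $ i) (unit_exp i + unit_exp j)"

lemma vanish: "v $ i = 0 \<Longrightarrow> eval_poly (\<theta> $ i) v = 0"
  using annihilator_preserves_hyperplane[OF nz dist annihilates axes, of v i]
    sum_mult_axis[of "\<lambda>k. v $ k" i 1] sum_mult_axis[of "\<lambda>k. eval_poly (\<theta> $ k) v" i 1]
  by (simp add: kernel_def mult.commute)

lemma hom_component: "homogeneous_poly 2 (\<theta> $ i)"
  using hom by (simp add: homogeneous_der_def)

lemma eval_component: "eval_poly (\<theta> $ i) v = v $ i * (\<Sum>j\<in>UNIV. M i j * v $ j)"
  unfolding M_def by (rule quadric_vanishing_on_coordinate_hyperplane(2)[OF hom_component vanish])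

text \<open>Vectors supported on at most three coordinates yield all the linear equations in use.
  The indices may coincide.\<close>

lemma relation:
  assumes a: "a \<in> set as" and "a $ i * x + a $ i' * y + a $ j * z = 0"
  shows "a $ i * x * (M i i * x + M i i' * y + M i j * z) + a $ i' * y * (M i' i * x + M i' i' * y + M i' j * z)
    + a $ j * z * (M j i * x + M j i' * y + M j j * z) = 0"
proof -
  define v where "v = axis i x + axis i' y + axis j z"
  have v: "(\<Sum>k\<in>UNIV. f k * v $ k) = f i * x + f i' * y + f j * z" for f
    by (simp add: v_def distrib_left sum.distrib sum_mult_axis)
  have "v \<in> kernel a" using assms(2) by (simp add: kernel_def v)
  then have "(\<Sum>k\<in>UNIV. a $ k * eval_poly (\<theta> $ k) v) = 0"
    by (rule annihilator_preserves_hyperplane[OF nz dist annihilates a])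
  then have "(\<Sum>k\<in>UNIV. a $ k * (v $ k * (M k i * x + M k i' * y + M k j * z))) = 0"
    by (simp only: eval_component v)
  then have "(\<Sum>k\<in>UNIV. (a $ k * (M k i * x + M k i' * y + M k j * z)) * v $ k) = 0"
    by (simp add: mult_ac)
  then show ?thesis unfolding v by (simp add: mult_ac)
qed

lemma reduced_coeff_M: "reduced_coeff \<theta> i j = M i j - M j j"
  by (simp add: reduced_coeff_def M_def)

lemma reduced_coeff_pair:
  assumes "a \<in> set as" and "a $ i \<noteq> 0" and "a $ j \<noteq> 0"
  shows "a $ i * reduced_coeff \<theta> i j + a $ j * reduced_coeff \<theta> j i = 0"
proof -
  have "a $ i * a $ j * (a $ i * (M i j - M j j) + a $ j * (M j i - M i i)) = 0"
    \<comment> \<open>The vector a_j e_i - a_i e_j lies in the hyperplane; the third slot repeats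
      \<open>i\<close> with coefficient 0.\<close>
    using relation[OF assms(1), of i "a $ j" j "- (a $ i)" i 0] by (simp add: algebra_simps)
  then show ?thesis using assms by (simp add: reduced_coeff_M)
qed

lemma reduced_coeff_eq:
  assumes "a \<in> set as" and "a $ i \<noteq> 0" and "a $ i' \<noteq> 0" and "a $ j = 0"
  shows "reduced_coeff \<theta> i j = reduced_coeff \<theta> i' j"
proof -
  have "a $ i * a $ i' * (M i j - M i' j) = 0"
    \<comment> \<open>As a_j = 0, adding e_j stays in the hyperplane. Subtracting the relations with
      and without e_j isolates the entries in column \<open>j\<close>.\<close>
    using relation[OF assms(1), of i "a $ i'" i' "- (a $ i)" j 1]
      relation[OF assms(1), of i "a $ i'" i' "- (a $ i)" j 0] assms(4) by (simp add: algebra_simps)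
  then show ?thesis using assms by (simp add: reduced_coeff_M)
qed

text \<open>In this case theta is the linear form with coefficients \<open>m\<close> times the Euler
  derivation, so it multiplies the product by \<open>length as\<close> times that form. As the
  result is 0, the space is covered by \<open>kernel m\<close> and the proper hyperplanes, which
  forces \<open>m\<close> to be 0.\<close>

lemma eq_0_if_reduced_coeffs_0:
  assumes "\<And>i j. i \<noteq> j \<Longrightarrow> reduced_coeff \<theta> i j = 0"
  shows "\<theta> = 0"
proof -
  define m where "m = (\<chi> j. M j j)"
  have M: "M i j = m $ j" for i j
    using assms[of i j] by (cases "i = j") (simp_all add: reduced_coeff_M m_def)
  have "v \<in> \<Union>(insert (kernel m) (kernel ` set as))" for v
  proof -
    have "0 = eval_poly (apply_der \<theta> (forms_prod as)) v" by (simp add: annihilates)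
    also have "\<dots> = (\<Sum>j\<in>UNIV. m $ j * v $ j) * (\<Sum>i\<in>UNIV. v $ i * eval_poly (partial_deriv i (forms_prod as)) v)"
      by (simp add: apply_der_eval eval_component M sum_distrib_left mult_ac)
    also have "(\<Sum>i\<in>UNIV. v $ i * eval_poly (partial_deriv i (forms_prod as)) v) =
        eval_poly (apply_der euler (forms_prod as)) v"
      by (simp add: apply_der_eval euler_def)
    also have "\<dots> = of_nat (length as) * eval_poly (forms_prod as) v"
      by (simp add: apply_euler_forms_prod)
    finally have "v \<in> kernel m \<or> length as = 0 \<or> eval_poly (forms_prod as) v = 0"
      by (auto simp: kernel_def)
    moreover have "length as \<noteq> 0" using axes by auto
    ultimately show ?thesis by (auto simp: eval_forms_prod_eq_0_iff)
  qed
  then have "UNIV \<subseteq> \<Union>(insert (kernel m) (kernel ` set as))" by blast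
  then obtain U where U: "U \<in> insert (kernel m) (kernel ` set as)" "UNIV \<subseteq> U"
  proof (rule subspace_subset_finite_Union[rotated 3])
    show "vec.subspace U" if "U \<in> insert (kernel m) (kernel ` set as)" for U
      using that subspace_kernel by blast
  qed (auto simp: vec.subspace_UNIV)
  have "kernel a \<noteq> UNIV" if "a \<in> set as" for a
    using kernel_neq_UNIV[of a] that nz by metis
  then have "kernel m = UNIV" using U by blast
  then have "m = 0" using kernel_neq_UNIV by blast
  then have "M i j = 0" for i j by (simp add: M)
  then have "lookup (\<theta> $ i) (unit_exp i + unit_exp j) = 0" for i j by (simp add: M_def)
  moreover have "lookup (\<theta> $ i) (unit_exp j + unit_exp k) = 0" if "j \<noteq> i" "k \<noteq> i" for i j k
    using quadric_vanishing_on_coordinate_hyperplane(1)[OF hom_component vanish] that by blast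
  ultimately have deg2: "lookup (\<theta> $ i) (unit_exp j + unit_exp k) = 0" for i j k
    by (metis add.commute)
  have "lookup (\<theta> $ i) m = 0" for i m
  proof (cases "mdeg m = 2")
    case True
    then show ?thesis using deg2 mdeg_eq_2E by metis
  next
    case False
    then show ?thesis using hom_component by (auto simp: homogeneous_poly_iff)
  qed
  then show ?thesis by (simp add: vec_eq_iff poly_mapping_eqI)
qed

lemma eq_0_if_rigid:
  assumes "rigid_at k l as" and "reduced_coeff \<theta> k l = 0"
  shows "\<theta> = 0"
proof (rule eq_0_if_reduced_coeffs_0)
  have 1: "\<forall>a\<in>set as. \<forall>i j. i \<noteq> j \<longrightarrow> a $ i \<noteq> 0 \<longrightarrow> a $ j \<noteq> 0 \<longrightarrow>
      a $ i * reduced_coeff \<theta> i j + a $ j * reduced_coeff \<theta> j i = 0"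
    using reduced_coeff_pair by blast
  have 2: "\<forall>a\<in>set as. \<forall>i i' j. a $ i \<noteq> 0 \<longrightarrow> a $ i' \<noteq> 0 \<longrightarrow> a $ j = 0 \<longrightarrow>
      reduced_coeff \<theta> i j = reduced_coeff \<theta> i' j"
    using reduced_coeff_eq by blast
  show "reduced_coeff \<theta> i j = 0" if "i \<noteq> j" for i j
    using assms(1)[unfolded rigid_at_def, rule_format, of "reduced_coeff \<theta>"] assms(2) 1 2 that by metis
qed

end

section \<open>Degrees of minimal generators of a rigid arrangement\<close>

lemma reduced_coeff_combination:
  "reduced_coeff (Const c *s \<theta> - Const d *s \<eta>) i j = c * reduced_coeff \<theta> i j - d * reduced_coeff \<eta> i j"
  by (simp add: reduced_coeff_def lookup_minus lookup_Const_mult algebra_simps)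

lemma smult_eq_0_iff: "p *s \<theta> = 0 \<longleftrightarrow> p = 0 \<or> \<theta> = 0" for \<theta> :: "'n::{finite,linorder} der"
  by (auto simp: vec_eq_iff)

lemma Var_neq_0: "(Var i :: 'n mpoly) \<noteq> 0"
  by (metis lookup_single_eq lookup_zero zero_neq_one Var_def)

lemma minimal_generators_irredundant:
  assumes "minimal_generators M G" and "\<gamma> \<in> G"
  shows "\<gamma> \<notin> Der.span (G - {\<gamma>})"
proof
  assume "\<gamma> \<in> Der.span (G - {\<gamma>})"
  then have "G \<subseteq> Der.span (G - {\<gamma>})" using Der.span_superset[of "G - {\<gamma>}"] by blast
  then have "Der.span G \<subseteq> Der.span (G - {\<gamma>})" by (rule Der.span_minimal) (rule Der.subspace_span)
  then have "Der.span (G - {\<gamma>}) = Der.span G" using Der.span_mono[of "G - {\<gamma>}" G] by blast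
  moreover have "G - {\<gamma>} \<subset> G" using assms(2) by blast
  ultimately show False using assms(1) by (metis minimal_generators_def)
qed

text \<open>The pair (\<open>k\<close>, \<open>l\<close>) names a coordinate: by
  \<open>rigid_at\<close>, the entry of \<open>reduced_coeff\<close> there is an injective
  functional on the quadratic annihilating derivations.\<close>

locale rigid_arrangement =
  fixes as :: "(complex ^ 'n::{finite,linorder}) list" and k l :: 'n
  assumes nz: "0 \<notin> set as" and dist: "distinct (map kernel as)"
    and axes: "\<And>i. axis i 1 \<in> set as"
    and rigid: "rigid_at k l as" and kl: "k \<noteq> l"
begin

definition D :: "'n der set" where
  "D = {\<theta>. apply_der \<theta> (forms_prod as) = 0}"

lemma subspace_D: "Der.subspace D"
  unfolding D_def by (rule subspace_annihilator)

lemma quadratic_eq_0: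
  assumes "\<theta> \<in> D" and "homogeneous_der 2 \<theta>" and "reduced_coeff \<theta> k l = 0"
  shows "\<theta> = 0"
proof -
  interpret quadratic_derivation as \<theta>
    using nz dist axes assms by unfold_locales (auto simp: D_def)
  show ?thesis using eq_0_if_rigid[OF rigid] assms by simp
qed

text \<open>The difference of the two sides is quadratic and has coordinate 0 at (\<open>k\<close>,
  \<open>l\<close>).\<close>

lemma quadratic_dependent:
  assumes "\<theta> \<in> D" and "homogeneous_der 2 \<theta>" and "\<eta> \<in> D" and "homogeneous_der 2 \<eta>"
  shows "Const (reduced_coeff \<eta> k l) *s \<theta> = Const (reduced_coeff \<theta> k l) *s \<eta>"
proof -
  let ?\<zeta> = "Const (reduced_coeff \<eta> k l) *s \<theta> - Const (reduced_coeff \<theta> k l) *s \<eta>"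
  have "?\<zeta> \<in> D" using assms subspace_D by (intro Der.subspace_diff Der.subspace_scale) auto
  moreover have "homogeneous_der 2 ?\<zeta>"
    using assms homogeneous_der_smult[OF homogeneous_poly_Const, of 2, unfolded add_0]
    by (intro homogeneous_der_diff)
  moreover have "reduced_coeff ?\<zeta> k l = 0" by (simp add: reduced_coeff_combination)
  ultimately have "?\<zeta> = 0" by (rule quadratic_eq_0)
  then show ?thesis by simp
qed

text \<open>A linear derivation \<open>\<theta>\<close> would yield the independent quadratic derivations \<open>x\<^sub>k \<theta>\<close> and \<open>x\<^sub>l \<theta>\<close>.\<close>

lemma linear_eq_0:
  assumes "\<theta> \<in> D" and "homogeneous_der 1 \<theta>"
  shows "\<theta> = 0"
proof (rule ccontr)
  assume ne: "\<theta> \<noteq> 0"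
  have inD: "Var i *s \<theta> \<in> D" and hom: "homogeneous_der 2 (Var i *s \<theta>)" for i
    using assms subspace_D homogeneous_der_smult[OF homogeneous_poly_Var assms(2)]
    by (auto intro: Der.subspace_scale simp: numeral_2_eq_2)
  define c where "c i = reduced_coeff (Var i *s \<theta>) k l" for i
  have c: "c i \<noteq> 0" for i
    using quadratic_eq_0[OF inD hom, of i] ne by (auto simp: smult_eq_0_iff Var_neq_0 c_def)
  have "(Const (c l) * Var k) *s \<theta> = (Const (c k) * Var l) *s \<theta>"
    using quadratic_dependent[OF inD hom inD hom, of l k] by (simp add: c_def mult.assoc)
  then have "(Const (c l) * Var k - Const (c k) * Var l) *s \<theta> = 0"
    by (simp add: Der.scale_left_diff_distrib)
  then have "Const (c l) * Var k = Const (c k) * Var l" 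
    using ne smult_eq_0_iff eq_iff_diff_eq_0 by metis
  then have "lookup (Const (c l) * Var k) (unit_exp k) = lookup (Const (c k) * Var l) (unit_exp k)" by simp
  moreover have "unit_exp k \<noteq> unit_exp l" using kl lookup_single_eq lookup_single_not_eq zero_neq_one by metis
  ultimately show False using c[of l]
    by (simp add: lookup_Const_mult Var_def lookup_single when_def split: if_splits)
qed

lemma homogeneous_degree_ge_2:
  assumes "\<theta> \<in> D" and "homogeneous_der d \<theta>" and "\<theta> \<noteq> 0"
  shows "2 \<le> d"
proof (rule ccontr)
  assume "\<not> 2 \<le> d"
  then consider "d = 0" | "d = 1" by linarith
  then show False
  proof cases
    case 1
    \<comment> \<open>A constant derivation times a variable is linear, which reduces degree 0 to
      degree 1.\<close>
    then have "homogeneous_der 1 (Var k *s \<theta>)"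
      using homogeneous_der_smult[OF homogeneous_poly_Var assms(2)] by simp
    then show False
      using linear_eq_0[of "Var k *s \<theta>"] assms subspace_D
      by (simp add: Der.subspace_scale smult_eq_0_iff Var_neq_0)
  qed (use linear_eq_0 assms in auto)
qed

text \<open>Two distinct quadratic generators would be proportional with a nonzero coordinate to
  divide by, so one would lie in the span of the others.\<close>

lemma quadratic_generator_unique:
  assumes G: "minimal_generators D G" and "\<gamma> \<in> G" "homogeneous_der 2 \<gamma>" "\<eta> \<in> G" "homogeneous_der 2 \<eta>"
  shows "\<gamma> = \<eta>"
proof (rule ccontr)
  assume ne: "\<gamma> \<noteq> \<eta>"
  have D: "\<gamma> \<in> D" "\<eta> \<in> D"
    using G assms(2,4) Der.span_superset[of G] by (auto simp: minimal_generators_def)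
  have irr: "\<zeta> \<notin> Der.span (G - {\<zeta>})" if "\<zeta> \<in> G" for \<zeta>
    by (rule minimal_generators_irredundant[OF G that])
  have "\<gamma> \<noteq> 0" using irr[OF assms(2)] Der.span_zero by metis
  then have c: "reduced_coeff \<gamma> k l \<noteq> 0" using quadratic_eq_0 D(1) assms(3) by blast
  have "Const (1 / reduced_coeff \<gamma> k l) *s (Const (reduced_coeff \<eta> k l) *s \<gamma>) =
      (Const (1 / reduced_coeff \<gamma> k l) * Const (reduced_coeff \<gamma> k l)) *s \<eta>"
    using quadratic_dependent[OF D(1) assms(3) D(2) assms(5)] by simp
  also have "\<dots> = \<eta>" using c by (simp flip: Const_mult)
  finally have "\<eta> \<in> Der.span (G - {\<eta>})"
    using assms(2) ne by (metis Der.span_base Der.span_scale Diff_iff singletonD)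
  then show False using irr[OF assms(4)] by simp
qed

text \<open>Irredundancy excludes 0, which is homogeneous of every degree. A second entry 2 would
  make two positions of the duplicate-free list of generators equal.\<close>

lemma degree_sequence_lower_bounds:
  assumes "degree_sequence D ds"
  shows "i < length ds \<Longrightarrow> 2 \<le> ds ! i" and "i < j \<Longrightarrow> j < length ds \<Longrightarrow> 3 \<le> ds ! j"
proof -
  obtain \<theta>s where ds: "sorted ds" and \<theta>s: "distinct \<theta>s" "minimal_generators D (set \<theta>s)"
    "list_all2 homogeneous_der ds \<theta>s"
    using assms by (auto simp: degree_sequence_def)
  have len: "length ds = length \<theta>s" using \<theta>s(3) by (rule list_all2_lengthD)
  have hom: "homogeneous_der (ds ! i) (\<theta>s ! i)" if "i < length ds" for i
    using \<theta>s(3) that by (simp add: list_all2_conv_all_nth)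
  have "\<theta>s ! i \<in> D" "\<theta>s ! i \<noteq> 0" if "i < length ds" for i
  proof -
    have i: "\<theta>s ! i \<in> set \<theta>s" using that len by simp
    then show "\<theta>s ! i \<in> D" using \<theta>s(2) Der.span_superset by (auto simp: minimal_generators_def)
    show "\<theta>s ! i \<noteq> 0" using minimal_generators_irredundant[OF \<theta>s(2) i] Der.span_zero by metis
  qed
  then show ge2: "2 \<le> ds ! i" if "i < length ds" for i
    using homogeneous_degree_ge_2 hom that by blast
  show "3 \<le> ds ! j" if ij: "i < j" "j < length ds"
  proof (rule ccontr)
    assume "\<not> 3 \<le> ds ! j"
    then have 2: "ds ! i = 2" "ds ! j = 2"
      using ge2[of i] sorted_nth_mono[OF ds, of i j] ij by auto
    then have "\<theta>s ! i = \<theta>s ! j"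
      using hom[of i] hom[of j] ij len by (intro quadratic_generator_unique[OF \<theta>s(2)]) auto
    then show False using \<theta>s(1) ij len by (simp add: nth_eq_iff_index_eq)
  qed
qed

lemma degree_sequence_exp0: "degree_sequence D (exp0 (kernel ` set as))"
proof -
  have D: "D0 (kernel ` set as) = D" unfolding D_def by (rule D0_kernels[OF nz dist])
  have "homcomp_der d \<theta> \<in> D" if "\<theta> \<in> D" for d \<theta>
    using that homcomp_der_annihilator[OF homogeneous_forms_prod] by (auto simp: D_def)
  then obtain G where "finite G" "Der.span G = D" "\<And>\<theta>. \<theta> \<in> G \<Longrightarrow> \<exists>d. homogeneous_der d \<theta>"
    using graded_submodule_finitely_generated[OF subspace_D] by metis
  then obtain ds where "degree_sequence D ds" using degree_sequence_exists by metis
  then show ?thesis unfolding exp0_def D by (rule someI)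
qed

end

lemma arr_type_bounds:
  fixes as :: "(complex ^ 4) list"
  assumes "length as = 8" and "0 \<notin> set as" and dist: "distinct (map kernel as)"
    and axes: "\<And>i. axis i 1 \<in> set as" and rigid: "rigid_at 1 2 as"
    and indep: "independent3 v1 v2 v3"
    and points: "\<And>v. v \<in> {v1, v2, v3} \<Longrightarrow> length (filter (\<lambda>a. v \<notin> kernel a) as) \<le> 4"
    and "central_arrangement \<A>" and "\<Union>\<A> = zero_locus (forms_prod as)"
  shows "arr_type \<A> \<in> {1, 2, 3, 4, 5}"
proof -
  interpret rigid_arrangement as 1 2
    using assms by unfold_locales auto
  have "\<Union>\<A> = \<Union>(kernel ` set as)" using assms(9) by (simp add: zero_locus_forms_prod)
  then have \<A>: "\<A> = kernel ` set as"
    using central_arrangement_eqI[OF assms(8) central_arrangement_kernels[OF nz]] by simp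
  have "card (set (map kernel as)) = 8" using distinct_card[OF dist] assms(1) by simp
  then have card: "card \<A> = 8" using \<A> by simp
  define ds where "ds = exp0 \<A>"
  have ds: "degree_sequence D ds" unfolding ds_def \<A> by (rule degree_sequence_exp0)
  then obtain \<theta>s where \<theta>s: "sorted ds" "minimal_generators D (set \<theta>s)" "list_all2 homogeneous_der ds \<theta>s"
    by (auto simp: degree_sequence_def)
  have upper: "i < length ds \<and> ds ! i \<le> 4" if "i < 3" for i
  proof (rule three_points_degrees_le[OF _ _ nz \<theta>s(1,3) _ indep points that])
    show "as \<noteq> []" using assms(1) by auto
    show "Der.span (set \<theta>s) = {\<theta>. apply_der \<theta> (forms_prod as) = 0}"
      using \<theta>s(2) by (simp add: minimal_generators_def D_def)
  qed simp_all
  have len: "3 \<le> length ds" using upper[of 2] by simp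
  have "take 3 ds = [ds ! 0, ds ! 1, ds ! 2]"
    using len by (intro nth_equalityI) (auto simp: less_Suc_eq numeral_3_eq_3 numeral_2_eq_2)
  \<comment> \<open>The 7 is 8 - 1, for eight hyperplanes; the three entries come from
    \<open>CARD(4) - 1\<close>.\<close>
  then have "arr_type \<A> = int (ds ! 0 + ds ! 1 + ds ! 2) - 7"
    by (simp add: arr_type_def card flip: ds_def)
  moreover have "0 < length ds" using len by linarith
  then have "2 \<le> ds ! 0" "3 \<le> ds ! 1" "3 \<le> ds ! 2"
    using degree_sequence_lower_bounds(1)[OF ds, of 0] degree_sequence_lower_bounds(2)[OF ds, of 0] len
    by auto
  moreover have "ds ! 0 \<le> 4" "ds ! 1 \<le> 4" "ds ! 2 \<le> 4" using upper by auto
  ultimately show ?thesis by auto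
qed

section \<open>The fourteen arrangements\<close>

lemma vector_4 [simp]:
  "(vector [a, b, c, d] :: 'a::zero ^ 4) $ 1 = a"
  "(vector [a, b, c, d] :: 'a::zero ^ 4) $ 2 = b"
  "(vector [a, b, c, d] :: 'a::zero ^ 4) $ 3 = c"
  "(vector [a, b, c, d] :: 'a::zero ^ 4) $ 4 = d"
  unfolding vector_def by auto

lemma ex_4: "(\<exists>i::4. P i) \<longleftrightarrow> P 1 \<or> P 2 \<or> P 3 \<or> P 4"
  using forall_4[of "\<lambda>i. \<not> P i"] by blast

text \<open>A nonzero 2x2 minor certifies that two normals are not proportional and can be checked
  by simplification.\<close>

lemma distinct_kernels:
  "sorted_wrt (\<lambda>a b. \<exists>i j. a $ i * b $ j \<noteq> a $ j * b $ i) as \<Longrightarrow> distinct (map kernel as)"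
proof (induction as)
  case (Cons a as)
  have "kernel a \<noteq> kernel b" if "b \<in> set as" for b
    using Cons.prems that kernel_subset_imp_minors[of a b] by fastforce
  then show ?case using Cons by auto
qed simp

abbreviation vec4 :: "complex \<Rightarrow> complex \<Rightarrow> complex \<Rightarrow> complex \<Rightarrow> complex ^ 4" where
  "vec4 a b c d \<equiv> vector [a, b, c, d]"

definition coordinate_normals :: "(complex ^ 4) list" where
  "coordinate_normals = [vec4 1 0 0 0, vec4 0 1 0 0, vec4 0 0 1 0, vec4 0 0 0 1]"

lemma axis_in_coordinate_normals: "axis i 1 \<in> set coordinate_normals"
proof -
  have "\<forall>i. axis i 1 \<in> set coordinate_normals"
    by (simp add: forall_4 coordinate_normals_def vec_eq_iff axis_def)
  then show ?thesis by blast
qed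

text \<open>The conditions of \<open>rigid_at\<close> for a single normal in dimension 4, with
  \<open>N i j\<close> replaced by scalar unknowns so that the linear system can be solved by
  substitution: six pair relations, and twelve equalities from the pairs combined with a third
  index.\<close>

definition relations :: "complex ^ 4 \<Rightarrow> complex \<Rightarrow> complex \<Rightarrow> complex \<Rightarrow> complex \<Rightarrow> complex \<Rightarrow> complex \<Rightarrow> complex \<Rightarrow> complex \<Rightarrow> complex \<Rightarrow> complex \<Rightarrow> complex \<Rightarrow> complex \<Rightarrow> bool" where
  "relations a n12 n13 n14 n21 n23 n24 n31 n32 n34 n41 n42 n43 \<longleftrightarrow>
    (a $ 1 \<noteq> 0 \<longrightarrow> a $ 2 \<noteq> 0 \<longrightarrow> a $ 1 * n12 + a $ 2 * n21 = 0) \<and>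
    (a $ 1 \<noteq> 0 \<longrightarrow> a $ 3 \<noteq> 0 \<longrightarrow> a $ 1 * n13 + a $ 3 * n31 = 0) \<and>
    (a $ 1 \<noteq> 0 \<longrightarrow> a $ 4 \<noteq> 0 \<longrightarrow> a $ 1 * n14 + a $ 4 * n41 = 0) \<and>
    (a $ 2 \<noteq> 0 \<longrightarrow> a $ 3 \<noteq> 0 \<longrightarrow> a $ 2 * n23 + a $ 3 * n32 = 0) \<and>
    (a $ 2 \<noteq> 0 \<longrightarrow> a $ 4 \<noteq> 0 \<longrightarrow> a $ 2 * n24 + a $ 4 * n42 = 0) \<and>
    (a $ 3 \<noteq> 0 \<longrightarrow> a $ 4 \<noteq> 0 \<longrightarrow> a $ 3 * n34 + a $ 4 * n43 = 0) \<and>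
    (a $ 1 \<noteq> 0 \<longrightarrow> a $ 2 \<noteq> 0 \<longrightarrow> a $ 3 = 0 \<longrightarrow> n13 = n23) \<and>
    (a $ 1 \<noteq> 0 \<longrightarrow> a $ 2 \<noteq> 0 \<longrightarrow> a $ 4 = 0 \<longrightarrow> n14 = n24) \<and>
    (a $ 1 \<noteq> 0 \<longrightarrow> a $ 3 \<noteq> 0 \<longrightarrow> a $ 2 = 0 \<longrightarrow> n12 = n32) \<and>
    (a $ 1 \<noteq> 0 \<longrightarrow> a $ 3 \<noteq> 0 \<longrightarrow> a $ 4 = 0 \<longrightarrow> n14 = n34) \<and>
    (a $ 1 \<noteq> 0 \<longrightarrow> a $ 4 \<noteq> 0 \<longrightarrow> a $ 2 = 0 \<longrightarrow> n12 = n42) \<and>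
    (a $ 1 \<noteq> 0 \<longrightarrow> a $ 4 \<noteq> 0 \<longrightarrow> a $ 3 = 0 \<longrightarrow> n13 = n43) \<and>
    (a $ 2 \<noteq> 0 \<longrightarrow> a $ 3 \<noteq> 0 \<longrightarrow> a $ 1 = 0 \<longrightarrow> n21 = n31) \<and>
    (a $ 2 \<noteq> 0 \<longrightarrow> a $ 3 \<noteq> 0 \<longrightarrow> a $ 4 = 0 \<longrightarrow> n24 = n34) \<and>
    (a $ 2 \<noteq> 0 \<longrightarrow> a $ 4 \<noteq> 0 \<longrightarrow> a $ 1 = 0 \<longrightarrow> n21 = n41) \<and>
    (a $ 2 \<noteq> 0 \<longrightarrow> a $ 4 \<noteq> 0 \<longrightarrow> a $ 3 = 0 \<longrightarrow> n23 = n43) \<and>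
    (a $ 3 \<noteq> 0 \<longrightarrow> a $ 4 \<noteq> 0 \<longrightarrow> a $ 1 = 0 \<longrightarrow> n31 = n41) \<and>
    (a $ 3 \<noteq> 0 \<longrightarrow> a $ 4 \<noteq> 0 \<longrightarrow> a $ 2 = 0 \<longrightarrow> n32 = n42)"

text \<open>The argument 0 of \<open>relations\<close> stands for \<open>N 1 2\<close>, the entry
  chosen as coordinate.\<close>

lemma rigid_at_I:
  assumes "\<And>n13 n14 n21 n23 n24 n31 n32 n34 n41 n42 n43. \<forall>a\<in>set as. relations a 0 n13 n14 n21 n23 n24 n31 n32 n34 n41 n42 n43 \<Longrightarrow>
      n13 = 0 \<and> n14 = 0 \<and> n21 = 0 \<and> n23 = 0 \<and> n24 = 0 \<and> n31 = 0 \<and>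
      n32 = 0 \<and> n34 = 0 \<and> n41 = 0 \<and> n42 = 0 \<and> n43 = 0"
  shows "rigid_at 1 2 as"
  unfolding rigid_at_def
proof (intro allI impI)
  fix N :: "4 \<Rightarrow> 4 \<Rightarrow> complex" and i j :: 4
  assume N: "N 1 2 = 0"
    and pair: "\<forall>a\<in>set as. \<forall>i j. i \<noteq> j \<longrightarrow> a $ i \<noteq> 0 \<longrightarrow> a $ j \<noteq> 0 \<longrightarrow> a $ i * N i j + a $ j * N j i = 0"
    and eq: "\<forall>a\<in>set as. \<forall>i i' j. a $ i \<noteq> 0 \<longrightarrow> a $ i' \<noteq> 0 \<longrightarrow> a $ j = 0 \<longrightarrow> N i j = N i' j"
    and "i \<noteq> j"
  have "relations a (N 1 2) (N 1 3) (N 1 4) (N 2 1) (N 2 3) (N 2 4) (N 3 1) (N 3 2) (N 3 4) (N 4 1) (N 4 2) (N 4 3)"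
    if a: "a \<in> set as" for a
  proof -
    have A: "a $ i \<noteq> 0 \<longrightarrow> a $ j \<noteq> 0 \<longrightarrow> a $ i * N i j + a $ j * N j i = 0" if "i \<noteq> j" for i j
      using pair a that by blast
    have B: "a $ i \<noteq> 0 \<longrightarrow> a $ i' \<noteq> 0 \<longrightarrow> a $ j = 0 \<longrightarrow> N i j = N i' j" for i i' j
      using eq a by blast
    show ?thesis unfolding relations_def by (intro conjI; (rule A, simp | rule B))
  qed
  then have "\<forall>a\<in>set as. relations a 0 (N 1 3) (N 1 4) (N 2 1) (N 2 3) (N 2 4) (N 3 1) (N 3 2) (N 3 4) (N 4 1) (N 4 2) (N 4 3)"
    by (simp add: N)
  then have "N 1 3 = 0 \<and> N 1 4 = 0 \<and> N 2 1 = 0 \<and> N 2 3 = 0 \<and> N 2 4 = 0 \<and> N 3 1 = 0 \<and>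
      N 3 2 = 0 \<and> N 3 4 = 0 \<and> N 4 1 = 0 \<and> N 4 2 = 0 \<and> N 4 3 = 0"
    by (rule assms)
  then have "\<forall>i j. i \<noteq> j \<longrightarrow> N i j = 0" using N by (simp add: forall_4)
  then show "N i j = 0" using \<open>i \<noteq> j\<close> by blast
qed

definition octic_data :: "(complex ^ 4) list \<Rightarrow> bool" where
  "octic_data as \<longleftrightarrow> length as = 8 \<and> 0 \<notin> set as \<and>
    sorted_wrt (\<lambda>a b. \<exists>i j. a $ i * b $ j \<noteq> a $ j * b $ i) as \<and> rigid_at 1 2 as \<and>
    (\<exists>v1 v2 v3. independent3 v1 v2 v3 \<and>
      (\<forall>v\<in>{v1, v2, v3}. length (filter (\<lambda>a. v \<notin> kernel a) as) \<le> 4))"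

text \<open>All but rigidity is plain evaluation on explicit vectors; rigidity is kept apart because
  it requires elimination in a linear system.\<close>

lemma octic_dataI:
  assumes "length bs = 4 \<and> 0 \<notin> set bs \<and>
      sorted_wrt (\<lambda>a b. \<exists>i j. a $ i * b $ j \<noteq> a $ j * b $ i) (coordinate_normals @ bs) \<and>
      independent3 v1 v2 v3 \<and>
      (\<forall>v\<in>{v1, v2, v3}. length (filter (\<lambda>a. v \<notin> kernel a) (coordinate_normals @ bs)) \<le> 4)"
    and "rigid_at 1 2 (coordinate_normals @ bs)"
  shows "octic_data (coordinate_normals @ bs)"
proof -
  have "length coordinate_normals = 4" "0 \<notin> set coordinate_normals"
    by (simp_all add: coordinate_normals_def vec_eq_iff forall_4)
  then show ?thesis using assms unfolding octic_data_def by auto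
qed

lemmas octic_simps = coordinate_normals_def vec_eq_iff forall_4 ex_4 independent3_def kernel_def sum_4

lemmas relations_simps = coordinate_normals_def relations_def add_eq_0_iff

text \<open>The pattern of the following checks. The points lie on at least four hyperplanes each,
  and coordinate points are taken as far as they do so. The linear equations have at most two terms,
  so n12 = 0 spreads by substitution: x + y gives n21, then y + z and z + w give n31 and n41, while
  w + x gives n42, and so on.\<close>

lemma octic_1: "octic_data (coordinate_normals @ [vec4 1 1 0 0, vec4 0 1 1 0, vec4 0 0 1 1, vec4 1 0 0 1])"
  by (rule octic_dataI[of _ "vec4 0 0 0 1" "vec4 0 0 1 0" "vec4 0 1 0 0"], simp add: octic_simps,
      rule rigid_at_I, simp (no_asm_use) add: relations_simps, (elim conjE, hypsubst_thin, simp)?)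

lemma octic_3: "octic_data (coordinate_normals @ [vec4 1 1 0 0, vec4 0 1 1 0, vec4 0 1 0 (- 1), vec4 1 (- 1) (- 1) 1])"
  by (rule octic_dataI[of _ "vec4 0 0 0 1" "vec4 0 0 1 0" "vec4 1 0 0 0"], simp add: octic_simps,
      rule rigid_at_I, simp (no_asm_use) add: relations_simps, (elim conjE, hypsubst_thin, simp)?)

lemma octic_19: "octic_data (coordinate_normals @ [vec4 1 1 0 0, vec4 0 1 1 0, vec4 1 0 (- 1) (- 1), vec4 1 1 1 (- 1)])"
  by (rule octic_dataI[of _ "vec4 0 0 0 1" "vec4 0 0 1 0" "vec4 0 1 0 0"], simp add: octic_simps,
      rule rigid_at_I, simp (no_asm_use) add: relations_simps, (elim conjE, hypsubst_thin, simp)?)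

lemma octic_32: "octic_data (coordinate_normals @ [vec4 1 1 0 0, vec4 0 1 1 0, vec4 1 (- 1) (- 1) (- 1), vec4 1 1 (- 1) 1])"
  by (rule octic_dataI[of _ "vec4 0 0 0 1" "vec4 0 0 1 0" "vec4 1 0 0 0"], simp add: octic_simps,
      rule rigid_at_I, simp (no_asm_use) add: relations_simps, (elim conjE, hypsubst_thin, simp)?)

lemma octic_69: "octic_data (coordinate_normals @ [vec4 1 1 0 0, vec4 1 (- 1) 1 0, vec4 1 (- 1) 0 (- 1), vec4 1 1 (- 1) (- 1)])"
  by (rule octic_dataI[of _ "vec4 0 0 0 1" "vec4 0 0 1 0" "vec4 (- 1) 1 0 0"], simp add: octic_simps,
      rule rigid_at_I, simp (no_asm_use) add: relations_simps, (elim conjE, hypsubst_thin, simp)?)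

lemma octic_93: "octic_data (coordinate_normals @ [vec4 1 1 0 0, vec4 1 (- 1) 1 0, vec4 0 1 (- 1) (- 1), vec4 1 0 1 (- 1)])"
  by (rule octic_dataI[of _ "vec4 0 0 0 1" "vec4 0 0 1 0" "vec4 0 1 0 0"], simp add: octic_simps,
      rule rigid_at_I, simp (no_asm_use) add: relations_simps, (elim conjE, hypsubst_thin, simp)?)

text \<open>The last four normals have no zero entry, so coordinate points lie on only three
  hyperplanes and sums of two coordinate vectors are used. For each pair of coordinates the signs
  agree in some normals and differ in others, so both entries of N vanish.\<close>

lemma octic_238: "octic_data (coordinate_normals @ [vec4 1 1 1 (- 1), vec4 1 1 (- 1) 1, vec4 1 (- 1) 1 1, vec4 (- 1) 1 1 1])"
  by (rule octic_dataI[of _ "vec4 0 0 1 1" "vec4 0 1 0 1" "vec4 1 0 0 1"], simp add: octic_simps,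
      rule rigid_at_I, simp (no_asm_use) add: relations_simps, (elim conjE, hypsubst_thin, simp)?)

lemma octic_239: "octic_data (coordinate_normals @ [vec4 1 1 1 0, vec4 1 1 0 1, vec4 1 0 1 1, vec4 0 1 1 1])"
  by (rule octic_dataI[of _ "vec4 0 0 0 1" "vec4 0 0 1 0" "vec4 0 1 0 0"], simp add: octic_simps,
      rule rigid_at_I, simp (no_asm_use) add: relations_simps, (elim conjE, hypsubst_thin, simp)?)

lemma octic_240: "octic_data (coordinate_normals @ [vec4 1 1 1 0, vec4 1 1 (- 1) 1, vec4 1 (- 1) 1 1, vec4 1 (- 1) (- 1) (- 1)])"
  by (rule octic_dataI[of _ "vec4 0 0 0 1" "vec4 0 0 (- 1) 1" "vec4 0 (- 1) 0 1"], simp add: octic_simps,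
      rule rigid_at_I, simp (no_asm_use) add: relations_simps, (elim conjE, hypsubst_thin, simp)?)

lemma octic_241: "octic_data (coordinate_normals @ [vec4 1 1 1 1, vec4 1 1 (- 1) (- 1), vec4 0 1 (- 1) 1, vec4 1 0 1 (- 1)])"
  by (rule octic_dataI[of _ "vec4 0 0 (- 1) 1" "vec4 0 1 0 0" "vec4 1 0 0 0"], simp add: octic_simps,
      rule rigid_at_I, simp (no_asm_use) add: relations_simps, (elim conjE, hypsubst_thin, simp)?)

lemma octic_245: "octic_data (coordinate_normals @ [vec4 1 1 1 0, vec4 0 1 1 1, vec4 1 (- 1) 0 (- 1), vec4 1 (- 1) 1 1])"
  by (rule octic_dataI[of _ "vec4 0 0 0 1" "vec4 0 0 1 0" "vec4 1 0 0 0"], simp add: octic_simps,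
      rule rigid_at_I, simp (no_asm_use) add: relations_simps, (elim conjE, hypsubst_thin, simp)?)

section \<open>The arrangements with coefficients involving the square roots of -3 and 5\<close>

lemma root_neqs:
  fixes r :: complex
  assumes "r\<^sup>2 = -3"
  shows "r \<noteq> 1" "1 \<noteq> r" "r \<noteq> - 1" "r + 1 \<noteq> 0" "- r \<noteq> 1"
proof -
  show "r \<noteq> 1" "1 \<noteq> r" and *: "r \<noteq> - 1" using assms by auto
  then show "r + 1 \<noteq> 0" "- r \<noteq> 1" by (metis add_eq_0_iff2 minus_minus)+
qed

lemma octic_A:
  assumes "r\<^sup>2 = -3"
  shows "octic_data (coordinate_normals @ [vec4 1 1 0 0, vec4 1 1 1 (- 1), vec4 (r - 1) (- 2) (r - 1) 0, vec4 0 2 (- r + 1) (- 2)])"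
  by (rule octic_dataI[of _ "vec4 0 0 0 1" "vec4 0 0 1 0" "vec4 1 0 0 0"],
      simp add: octic_simps root_neqs[OF assms], rule rigid_at_I,
      simp (no_asm_use) add: relations_simps root_neqs[OF assms], (elim conjE, hypsubst_thin, simp add: root_neqs[OF assms])?)

lemma octic_B:
  assumes "r\<^sup>2 = -3"
  shows "octic_data (coordinate_normals @ [vec4 1 1 1 0, vec4 1 0 1 (- 1), vec4 (r - 1) (r + 1) (- 2) 2, vec4 (r - 1) (r - 1) (- 2) (r + 1)])"
proof (rule octic_dataI[of _ "vec4 0 0 0 1" "vec4 0 1 0 0" "vec4 (- 1) 0 1 0"])
  note r = root_neqs[OF assms]
  show "rigid_at 1 2 (coordinate_normals @ [vec4 1 1 1 0, vec4 1 0 1 (- 1), vec4 (r - 1) (r + 1) (- 2) 2, vec4 (r - 1) (r - 1) (- 2) (r + 1)])"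
  proof (rule rigid_at_I)
    fix n13 n14 n21 n23 n24 n31 n32 n34 n41 n42 n43
    assume "\<forall>a\<in>set (coordinate_normals @ [vec4 1 1 1 0, vec4 1 0 1 (- 1), vec4 (r - 1) (r + 1) (- 2) 2, vec4 (r - 1) (r - 1) (- 2) (r + 1)]). relations a 0 n13 n14 n21 n23 n24 n31 n32 n34 n41 n42 n43"
    then have "n21 = 0 \<and> n31 = - n13 \<and> n32 = - n23 \<and> n14 = n24 \<and> n14 = n34 \<and> n41 = n14 \<and> n43 = n34 \<and>
        n32 = 0 \<and> n42 = 0 \<and> 2 * n31 = (r - 1) * n13 \<and> 2 * n41 = - ((r - 1) * n14)"
      by (simp (no_asm_use) add: relations_simps r, blast)
    \<comment> \<open>Two normals relate n13 and n31 with different ratios: n31 = - n13 and 2 * n31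
      = (r - 1) * n13. The same happens for n14 and n41. The factor r + 1 is nonzero because r * r =
      -3.\<close>
    moreover from this have "(r + 1) * n13 = 0" "(r + 1) * n14 = 0" by (auto simp: algebra_simps add_eq_0_iff)
    ultimately show "n13 = 0 \<and> n14 = 0 \<and> n21 = 0 \<and> n23 = 0 \<and> n24 = 0 \<and> n31 = 0 \<and>
      n32 = 0 \<and> n34 = 0 \<and> n41 = 0 \<and> n42 = 0 \<and> n43 = 0"
      using r by auto
  qed
qed (simp add: octic_simps root_neqs[OF assms])

lemma root_neqs5:
  fixes s :: complex
  assumes "s\<^sup>2 = 5"
  shows "s \<noteq> 1" "1 \<noteq> s" "3 \<noteq> s" "s \<noteq> 3" "s + 1 \<noteq> 0"
  using assms by (auto simp: add_eq_0_iff2)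

lemma octic_C:
  fixes s :: complex
  assumes "s\<^sup>2 = 5"
  shows "octic_data (coordinate_normals @ [vec4 1 1 1 0, vec4 0 (s - 1) (- 2) 2, vec4 2 2 0 (s - 1), vec4 (- s + 3) 2 (- s + 1) (s - 1)])"
proof (rule octic_dataI[of _ "vec4 0 0 0 1" "vec4 0 0 1 0" "vec4 1 0 0 0"])
  note s = root_neqs5[OF assms]
  show "rigid_at 1 2 (coordinate_normals @ [vec4 1 1 1 0, vec4 0 (s - 1) (- 2) 2, vec4 2 2 0 (s - 1), vec4 (- s + 3) 2 (- s + 1) (s - 1)])"
  proof (rule rigid_at_I)
    fix n13 n14 n21 n23 n24 n31 n32 n34 n41 n42 n43
    assume "\<forall>a\<in>set (coordinate_normals @ [vec4 1 1 1 0, vec4 0 (s - 1) (- 2) 2, vec4 2 2 0 (s - 1), vec4 (- s + 3) 2 (- s + 1) (s - 1)]). relations a 0 n13 n14 n21 n23 n24 n31 n32 n34 n41 n42 n43"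
    then have "n21 = 0 \<and> n31 = - n13 \<and> n32 = - n23 \<and> n14 = n24 \<and> n14 = n34 \<and> n43 = n34 \<and>
        n21 = n31 \<and> n21 = n41 \<and> 2 * n32 = (s - 1) * n23 \<and> 2 * n42 = - ((s - 1) * n24) \<and>
        (s - 1) * n41 = - (2 * n14)"
      by (simp (no_asm_use) add: relations_simps s, blast)
    \<comment> \<open>Again two ratios: x + y + z gives n32 = - n23, and the next normal gives 2 *
      n32 = (s - 1) * n23.\<close>
    moreover from this have "(s + 1) * n23 = 0" by (auto simp: algebra_simps add_eq_0_iff)
    ultimately show "n13 = 0 \<and> n14 = 0 \<and> n21 = 0 \<and> n23 = 0 \<and> n24 = 0 \<and> n31 = 0 \<and>
      n32 = 0 \<and> n34 = 0 \<and> n41 = 0 \<and> n42 = 0 \<and> n43 = 0"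
      using s by auto
  qed
qed (simp add: octic_simps root_neqs5[OF assms])

text \<open>The bridge from the given polynomials to lists of normals: expanding the linear forms
  over the four coordinates reproduces the factors in their order.\<close>

lemma rigid_octic_polys_subset:
  fixes r :: complex
  defines "s \<equiv> complex_of_real (sqrt 5)"
  shows "rigid_octic_polys r \<subseteq> (\<lambda>bs. forms_prod (coordinate_normals @ bs)) `
   {[vec4 1 1 0 0, vec4 0 1 1 0, vec4 0 0 1 1, vec4 1 0 0 1],
    [vec4 1 1 0 0, vec4 0 1 1 0, vec4 0 1 0 (- 1), vec4 1 (- 1) (- 1) 1],
    [vec4 1 1 0 0, vec4 0 1 1 0, vec4 1 0 (- 1) (- 1), vec4 1 1 1 (- 1)],
    [vec4 1 1 0 0, vec4 0 1 1 0, vec4 1 (- 1) (- 1) (- 1), vec4 1 1 (- 1) 1],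
    [vec4 1 1 0 0, vec4 1 (- 1) 1 0, vec4 1 (- 1) 0 (- 1), vec4 1 1 (- 1) (- 1)],
    [vec4 1 1 0 0, vec4 1 (- 1) 1 0, vec4 0 1 (- 1) (- 1), vec4 1 0 1 (- 1)],
    [vec4 1 1 1 (- 1), vec4 1 1 (- 1) 1, vec4 1 (- 1) 1 1, vec4 (- 1) 1 1 1],
    [vec4 1 1 1 0, vec4 1 1 0 1, vec4 1 0 1 1, vec4 0 1 1 1],
    [vec4 1 1 1 0, vec4 1 1 (- 1) 1, vec4 1 (- 1) 1 1, vec4 1 (- 1) (- 1) (- 1)],
    [vec4 1 1 1 1, vec4 1 1 (- 1) (- 1), vec4 0 1 (- 1) 1, vec4 1 0 1 (- 1)],
    [vec4 1 1 1 0, vec4 0 1 1 1, vec4 1 (- 1) 0 (- 1), vec4 1 (- 1) 1 1],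
    [vec4 1 1 0 0, vec4 1 1 1 (- 1), vec4 (r - 1) (- 2) (r - 1) 0, vec4 0 2 (- r + 1) (- 2)],
    [vec4 1 1 1 0, vec4 1 0 1 (- 1), vec4 (r - 1) (r + 1) (- 2) 2, vec4 (r - 1) (r - 1) (- 2) (r + 1)],
    [vec4 1 1 1 0, vec4 0 (s - 1) (- 2) 2, vec4 2 2 0 (s - 1), vec4 (- s + 3) 2 (- s + 1) (s - 1)]}"
  unfolding rigid_octic_polys_def Let_def s_def[symmetric]
  by (simp add: forms_prod_def coordinate_normals_def linear_form_def sum_4 Const_uminus mult.assoc)

theorem theorem5p1:
  fixes r :: complex and Q :: "4 mpoly" and \<A> :: "(complex ^ 4) set set"
  assumes "r\<^sup>2 = -3"
    and "Q \<in> rigid_octic_polys r"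
    and "central_arrangement \<A>"
    and "\<Union>\<A> = zero_locus Q"
  shows "arr_type \<A> \<in> {1, 2, 3, 4, 5}"
proof -
  have s: "(complex_of_real (sqrt 5))\<^sup>2 = 5" by (simp flip: of_real_power)
  obtain bs where Q: "Q = forms_prod (coordinate_normals @ bs)" and data: "octic_data (coordinate_normals @ bs)"
    using subsetD[OF rigid_octic_polys_subset assms(2)]
      octic_1 octic_3 octic_19 octic_32 octic_69 octic_93 octic_238 octic_239 octic_240 octic_241 octic_245
      octic_A[OF assms(1)] octic_B[OF assms(1)] octic_C[OF s]
    by (elim imageE insertE emptyE) (simp_all only:)
  then obtain v1 v2 v3 where indep: "independent3 v1 v2 v3"
    and points: "\<And>v. v \<in> {v1, v2, v3} \<Longrightarrow> length (filter (\<lambda>a. v \<notin> kernel a) (coordinate_normals @ bs)) \<le> 4"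
    unfolding octic_data_def by blast
  show ?thesis
  proof (rule arr_type_bounds[OF _ _ _ _ _ indep points assms(3)])
    show "length (coordinate_normals @ bs) = 8" "0 \<notin> set (coordinate_normals @ bs)"
      "rigid_at 1 2 (coordinate_normals @ bs)"
      using data by (simp_all add: octic_data_def)
    show "distinct (map kernel (coordinate_normals @ bs))"
      using data unfolding octic_data_def by (blast intro: distinct_kernels)
    show "axis i 1 \<in> set (coordinate_normals @ bs)" for i
      using axis_in_coordinate_normals by simp
    show "\<Union>\<A> = zero_locus (forms_prod (coordinate_normals @ bs))"
      using assms(4) Q by simp
  qed
qed

end
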